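(* Let $S$ be a finite inverse semigroup with $\mathcal D$-classes $D_0,\dots,D_n$, chosen idempotents $e_j\in D_j$, maximal subgroups $G_j$ of $S$ at $e_j$, chosen elements $p_e$ for idempotents $e\in S$, and complete sets $\mathrm{IRR}(G_j)$ of inequivalent irreducible representations of $\mathbb C G_j$, with induced representations $\bar\rho$ of $\mathbb C S$ for $\rho\in\biguplus_j\mathrm{IRR}(G_j)$ (all as described in the context). Let $g=\sum_{s\in S}g(s)\lfloor s\rfloor\in\mathbb C S$, let $s\in D_k$, and let $y=p_{\mathrm{ran}(s)}^{-1}\,s\,p_{\mathrm{dom}(s)}\in G_k$. For $\rho\in\mathrm{IRR}(G_k)$, view $\hat g(\bar\rho)$ as an $r_k\times r_k$ matrix whose rows and columns are indexed by the idempotents of $D_k$ and whose entries $\hat g(\bar\rho)_{a,b}$ are $d_\rho\times d_\rho$ matrices. Then \[ g(s)=\frac1{|G_k|}\sum_{\rho\in\mathrm{IRR}(G_k)}d_\rho\,\mathrm{trace}\!\left(\hat g(\bar\rho)_{\mathrm{ran}(s),\mathrm{dom}(s)}\,\rho(y^{-1})\right). \]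
   Context: An inverse semigroup is a semigroup $S$ in which each $x$ has a unique $x^{-1}$ with $xx^{-1}x=x$, $x^{-1}xx^{-1}=x^{-1}$. Write $\mathrm{dom}(s)=s^{-1}s$, $\mathrm{ran}(s)=ss^{-1}$. Natural partial order: $t\leq s$ iff $t=es$ for some idempotent $e$; $\mu$ is its M\"obius function. $s\mathrel{\mathcal D}t$ iff there is $x\in S$ with $\mathrm{dom}(x)=\mathrm{ran}(s)$, $\mathrm{ran}(x)=\mathrm{ran}(t)$ (an equivalence relation with classes the $\mathcal D$-classes). The maximal subgroup at an idempotent $e$ is $\{s\in S:\mathrm{dom}(s)=\mathrm{ran}(s)=e\}$. $r_k$ is the number of idempotents in $D_k$. Groupoid basis: $\lfloor s\rfloor=\sum_{t\leq s}\mu(t,s)t$ for $s\in S$; these form a basis of the semigroup algebra $\mathbb C S$. For each idempotent $e\in D_k$, $p_e\in S$ is a fixed element with $\mathrm{dom}(p_e)=e_k$, $\mathrm{ran}(p_e)=e$, and $p_{e_k}=e_k$. A representation is an algebra homomorphism to $M_{d}(\mathbb C)$, of dimension $d=d_\rho$. For $\rho\in\mathrm{IRR}(G_k)$, the induced representation $\bar\rho$ of $\mathbb C S$, of dimension $r_kd_\rho$, is the linear map with $\bar\rho(\lfloor s\rfloor)=E_{\mathrm{ran}(s),\mathrm{dom}(s)}\otimes\rho(p_{\mathrm{ran}(s)}^{-1}\,s\,p_{\mathrm{dom}(s)})$ if $s\in D_k$, and $\bar\rho(\lfloor s\rfloor)=0$ otherwise, where $E_{a,b}$ are the $r_k\times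 r_k$ matrix units indexed by idempotents of $D_k$. The set $\mathcal Y=\{\bar\rho\}$ is a complete set of inequivalent irreducible representations of $\mathbb C S$. For $g\in\mathbb C S$ and a representation $\rho$ of $\mathbb C S$, $\hat g(\rho)=\rho(g)$; thus here $\hat g(\bar\rho)=\sum_{x\in S}g(x)\bar\rho(\lfloor x\rfloor)$. *)

theory Defs
  imports "Jordan_Normal_Form.VS_Connect"
begin

subsection \<open>Inverse semigroups\<close>

class inverse_semigroup = semigroup_mult +
  assumes ex1_inverse: "\<exists>!y. x * y * x = x \<and> y * x * y = y"

definition sinv :: "'a::inverse_semigroup \<Rightarrow> 'a" where
  "sinv x = (THE y. x * y * x = x \<and> y * x * y = y)"

definition sdom :: "'a::inverse_semigroup \<Rightarrow> 'a" where
  "sdom s = sinv s * s"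

definition sran :: "'a::inverse_semigroup \<Rightarrow> 'a" where
  "sran s = s * sinv s"

definition idempotents :: "'a::inverse_semigroup set" where
  "idempotents = {e. e * e = e}"

definition nat_le :: "'a::inverse_semigroup \<Rightarrow> 'a \<Rightarrow> bool" (infix "\<preceq>" 50) where
  "t \<preceq> s \<longleftrightarrow> (\<exists>e\<in>idempotents. t = e * s)"

definition D_rel :: "('a::inverse_semigroup \<times> 'a) set" where
  "D_rel = {(s, t). \<exists>x. sdom x = sran s \<and> sran x = sran t}"

definition max_subgroup :: "'a::inverse_semigroup \<Rightarrow> 'a set" where
  "max_subgroup e = {s. sdom s = e \<and> sran s = e}"

definition moebius :: "'a::{finite, inverse_semigroup} \<Rightarrow> 'a \<Rightarrow> int" where
  "moebius = (THE \<mu>. \<forall>t s.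
     (t \<preceq> s \<longrightarrow> (\<Sum>u | t \<preceq> u \<and> u \<preceq> s. \<mu> t u) = (if t = s then 1 else 0)) \<and>
     (\<not> t \<preceq> s \<longrightarrow> \<mu> t s = 0))"


subsection \<open>Semigroup algebras and their representations\<close>

text \<open>
  An element of the complex algebra of a finite semigroup is its coefficient function. For a
  subsemigroup \<open>H\<close>, such as a maximal subgroup, the algebra of \<open>H\<close> is the subspace of functions
  supported on \<open>H\<close>, with the same product.
\<close>

type_synonym 'a alg = "'a \<Rightarrow> complex"

definition single :: "'a \<Rightarrow> 'a alg" where
  "single s = (\<lambda>x. if x = s then 1 else 0)"

definition conv :: "'a::{finite, semigroup_mult} alg \<Rightarrow> 'a alg \<Rightarrow> 'a alg" where
  "conv f g = (\<lambda>x. \<Sum>(a, b) | a * b = x. f a * g b)"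

definition alg_on :: "'a set \<Rightarrow> 'a alg set" where
  "alg_on H = {f. \<forall>x. x \<notin> H \<longrightarrow> f x = 0}"

definition groupoid_basis :: "'a::{finite, inverse_semigroup} \<Rightarrow> 'a alg" where
  "groupoid_basis s = (\<lambda>x. \<Sum>t | t \<preceq> s. of_int (moebius t s) * single t x)"

definition linear_to_mat :: "'a alg set \<Rightarrow> nat \<Rightarrow> ('a alg \<Rightarrow> complex mat) \<Rightarrow> bool" where
  "linear_to_mat A d R \<longleftrightarrow>
     (\<forall>f\<in>A. R f \<in> carrier_mat d d) \<and>
     (\<forall>f\<in>A. \<forall>g\<in>A. R (\<lambda>x. f x + g x) = R f + R g) \<and>
     (\<forall>c. \<forall>f\<in>A. R (\<lambda>x. c * f x) = c \<cdot>\<^sub>m R f)"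

text \<open>
  Here \<open>e\<close> is the identity element of \<open>H\<close>, and algebra homomorphisms are unital.
\<close>

definition representation ::
    "'a::{finite, semigroup_mult} set \<Rightarrow> 'a \<Rightarrow> nat \<Rightarrow> ('a alg \<Rightarrow> complex mat) \<Rightarrow> bool" where
  "representation H e d \<rho> \<longleftrightarrow>
     linear_to_mat (alg_on H) d \<rho> \<and>
     (\<forall>f\<in>alg_on H. \<forall>g\<in>alg_on H. \<rho> (conv f g) = \<rho> f * \<rho> g) \<and>
     \<rho> (single e) = 1\<^sub>m d"

text \<open>All values of a representation have the same size, so the dimension can be read off at \<open>0\<close>.\<close>

definition rep_dim :: "('a alg \<Rightarrow> complex mat) \<Rightarrow> nat" where
  "rep_dim \<rho> = dim_row (\<rho> (\<lambda>_. 0))"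

definition irreducible_rep ::
    "'a::{finite, semigroup_mult} set \<Rightarrow> 'a \<Rightarrow> ('a alg \<Rightarrow> complex mat) \<Rightarrow> bool" where
  "irreducible_rep H e \<rho> \<longleftrightarrow>
     representation H e (rep_dim \<rho>) \<rho> \<and> rep_dim \<rho> > 0 \<and>
     (\<forall>W. VectorSpace.subspace class_ring W (module_vec TYPE(complex) (rep_dim \<rho>)) \<and>
          (\<forall>f\<in>alg_on H. \<forall>w\<in>W. \<rho> f *\<^sub>v w \<in> W)
        \<longrightarrow> W = {0\<^sub>v (rep_dim \<rho>)} \<or> W = carrier_vec (rep_dim \<rho>))"

definition equivalent_reps ::
    "'a set \<Rightarrow> ('a alg \<Rightarrow> complex mat) \<Rightarrow> ('a alg \<Rightarrow> complex mat) \<Rightarrow> bool" where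
  "equivalent_reps H \<rho> \<sigma> \<longleftrightarrow> (\<exists>P Q. \<forall>f\<in>alg_on H. similar_mat_wit (\<rho> f) (\<sigma> f) P Q)"

definition complete_irreps ::
    "'a::{finite, semigroup_mult} set \<Rightarrow> 'a \<Rightarrow> ('a alg \<Rightarrow> complex mat) set \<Rightarrow> bool" where
  "complete_irreps H e I \<longleftrightarrow>
     (\<forall>\<rho>\<in>I. irreducible_rep H e \<rho>) \<and>
     (\<forall>\<rho>\<in>I. \<forall>\<sigma>\<in>I. equivalent_reps H \<rho> \<sigma> \<longrightarrow> \<rho> = \<sigma>) \<and>
     (\<forall>\<rho>. irreducible_rep H e \<rho> \<longrightarrow> (\<exists>\<sigma>\<in>I. equivalent_reps H \<rho> \<sigma>))"


subsection \<open>Induced representations\<close>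

definition mat_unit :: "nat \<Rightarrow> nat \<Rightarrow> nat \<Rightarrow> complex mat" where
  "mat_unit r a b = mat r r (\<lambda>(i, j). if i = a \<and> j = b then 1 else 0)"

definition kronecker :: "complex mat \<Rightarrow> complex mat \<Rightarrow> complex mat" where
  "kronecker A B = mat (dim_row A * dim_row B) (dim_col A * dim_col B)
     (\<lambda>(i, j). A $$ (i div dim_row B, j div dim_col B) * B $$ (i mod dim_row B, j mod dim_col B))"

text \<open>The \<open>(a, b)\<close> entry of a matrix regarded as a matrix of \<open>d \<times> d\<close> blocks.\<close>

definition mat_block :: "nat \<Rightarrow> complex mat \<Rightarrow> nat \<Rightarrow> nat \<Rightarrow> complex mat" where
  "mat_block d M a b = mat d d (\<lambda>(i, j). M $$ (a * d + i, b * d + j))"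

definition mat_trace :: "complex mat \<Rightarrow> complex" where
  "mat_trace A = (\<Sum>i<dim_row A. A $$ (i, i))"

text \<open>
  \<open>Dk\<close> is a \<open>\<D>\<close>-class, \<open>ix\<close> numbers its idempotents by \<open>0, \<dots>, r\<^sub>k - 1\<close>, so that matrices with
  rows and columns indexed by these idempotents become ordinary matrices, and \<open>p\<close> is the choice
  of elements from the chosen idempotent of \<open>Dk\<close> to the others.
\<close>

definition induced_rep ::
    "'a::{finite, inverse_semigroup} set \<Rightarrow> ('a \<Rightarrow> nat) \<Rightarrow> ('a \<Rightarrow> 'a)
      \<Rightarrow> ('a alg \<Rightarrow> complex mat) \<Rightarrow> 'a alg \<Rightarrow> complex mat" where
  "induced_rep Dk ix p \<rho> =
     (let r = card (idempotents \<inter> Dk); d = rep_dim \<rho> in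
      THE R. linear_to_mat (alg_on UNIV) (r * d) R \<and>
        (\<forall>s. R (groupoid_basis s) =
          (if s \<in> Dk
           then kronecker (mat_unit r (ix (sran s)) (ix (sdom s)))
                  (\<rho> (single (sinv (p (sran s)) * s * p (sdom s))))
           else 0\<^sub>m (r * d) (r * d))))"

end

theory Submission
  imports Defs "Jordan_Normal_Form.Spectral_Radius" "HOL-Library.Function_Algebras"
begin

text \<open>
  The Fourier transform \<open>induced_rep\<close> spreads the restriction of \<open>g\<close> to a \<open>\<D>\<close>-class over matrix
  blocks: the block at \<open>(a, b)\<close> is the sum of \<open>g t\<close> times \<open>\<rho> (z t)\<close> over the elements \<open>t\<close> of the class
  with range \<open>a\<close> and domain \<open>b\<close>, where \<open>z t = sinv (p a) * t * p b\<close> lies in the maximal subgroup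
  \<open>G\<close>. The map \<open>z\<close> is injective on these elements, because \<open>p a * z t * sinv (p b) = t\<close>.
  Multiplying the block by \<open>\<rho> (sinv y)\<close>, taking the trace and summing over \<open>\<rho>\<close> with weights
  \<open>rep_dim \<rho>\<close> therefore produces the sum of \<open>g t\<close> times
  \<open>\<Sum>\<rho>. rep_dim \<rho> * character \<rho> (z t * sinv y)\<close>. By \<open>column_orthogonality\<close> for \<open>G\<close>, the last sum
  is \<open>card G\<close> if \<open>z t = y\<close>, that is, if \<open>t = s\<close>, and vanishes otherwise.

  Two facts support this computation. First, the groupoid basis is a basis, so that the description
  of \<open>induced_rep\<close> on it has exactly one linear extension (\<open>ex1_linear_on_groupoid_basis\<close>). This is
  Moebius inversion for the natural partial order: the coordinate of \<open>f\<close> at \<open>t\<close> is the sum of \<open>f\<close>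
  over all elements above \<open>t\<close>.

  Second, column orthogonality holds for a complete set of irreducible representations of a finite
  group. Schur's lemma gives the orthogonality relations for matrix coefficients, hence also the
  finiteness of the set, and it shows that the group algebra element
  \<open>F = card G * single e - (\<Sum>x\<in>G. (\<Sum>\<rho>. rep_dim \<rho> * character \<rho> (inverse of x)) * single x)\<close>
  acts as zero in every irreducible representation. It remains to see that only \<open>0\<close> acts as zero in
  all of them (\<open>annihilated_by_irreducibles_eq_0\<close>). The elements that do so form a left ideal. If
  it were nonzero, it would contain a minimal nonzero left ideal \<open>U\<close>. Such a \<open>U\<close> is itself an
  irreducible module, so \<open>U\<close> kills \<open>U\<close>. For \<open>u\<close> in \<open>U\<close> and \<open>v = conv (star u) u\<close>, also in \<open>U\<close>,
  this gives \<open>conv v v = 0\<close>; as \<open>v\<close> is self-adjoint, positivity forces \<open>v = 0\<close> and then \<open>u = 0\<close>.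
\<close>

section \<open>Inverse semigroups\<close>

lemma sinv_props:
  fixes x :: "'a::inverse_semigroup"
  shows "x * sinv x * x = x" and "sinv x * x * sinv x = sinv x"
  using theI'[OF ex1_inverse[of x]] unfolding sinv_def by auto

lemma sinv_eqI:
  fixes x :: "'a::inverse_semigroup"
  assumes "x * y * x = x" "y * x * y = y"
  shows "sinv x = y"
  unfolding sinv_def by (rule the1_equality[OF ex1_inverse]) (use assms in auto)

lemma sinv_sinv [simp]: "sinv (sinv x) = (x::'a::inverse_semigroup)"
  by (rule sinv_eqI) (fact sinv_props)+

lemma sinv_cancel_right:
  fixes x :: "'a::inverse_semigroup"
  shows "x * (sinv x * x) = x" and "sinv x * (x * sinv x) = sinv x"
    and "x * (sinv x * (x * z)) = x * z" and "sinv x * (x * (sinv x * z)) = sinv x * z"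
  using sinv_props[of x] by (simp_all add: mult.assoc) (metis mult.assoc)+

lemma idempotent_sinv: "e \<in> idempotents \<Longrightarrow> sinv e = e"
  by (rule sinv_eqI) (simp_all add: idempotents_def)

text \<open>
  The inverse \<open>x\<close> of a product \<open>e * f\<close> of idempotents equals \<open>f * x * e\<close>, which is idempotent.
  An idempotent is its own inverse, so \<open>e * f = x\<close> is idempotent.
\<close>

lemma idempotents_mult_closed:
  fixes e f :: "'a::inverse_semigroup"
  assumes e: "e \<in> idempotents" and f: "f \<in> idempotents"
  shows "e * f \<in> idempotents"
proof -
  define x where "x = sinv (e * f)"
  have e2: "e * e = e" and f2: "f * f = f"
    using e f by (auto simp: idempotents_def)
  have e3: "e * (e * z) = e * z" and f3: "f * (f * z) = f * z" for z
    by (metis e2 f2 mult.assoc)+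
  have x1: "e * (f * (x * (e * f))) = e * f" and x2: "x * (e * (f * x)) = x"
    using sinv_props[of "e * f"] by (simp_all add: x_def mult.assoc)
  have x2': "x * (e * (f * (x * z))) = x * z" for z
    by (metis x2 mult.assoc)
  have fxe: "x = f * x * e"
    unfolding x_def
    by (rule sinv_eqI)
       (simp_all add: mult.assoc e2 f2 e3 f3 x1 x2' flip: x_def)
  have "x * x = f * (x * (e * (f * (x * e))))"
    by (subst fxe, subst (2) fxe) (simp add: mult.assoc)
  also have "\<dots> = f * x * e"
    by (simp add: x2' mult.assoc)
  also have "\<dots> = x"
    by (rule fxe[symmetric])
  finally have "x \<in> idempotents"
    by (simp add: idempotents_def)
  then show ?thesis
    using idempotent_sinv[of x] x_def by simp
qed

text \<open>
  Since \<open>e * f\<close> and \<open>f * e\<close> are both idempotent, \<open>f * e\<close> is an inverse of \<open>e * f\<close>; but so is the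
  idempotent \<open>e * f\<close> itself, and inverses are unique.
\<close>

lemma idempotents_commute:
  fixes e f :: "'a::inverse_semigroup"
  assumes e: "e \<in> idempotents" and f: "f \<in> idempotents"
  shows "e * f = f * e"
proof -
  have e2: "e * e = e" and f2: "f * f = f"
    using e f by (auto simp: idempotents_def)
  have e3: "e * (e * z) = e * z" and f3: "f * (f * z) = f * z" for z
    by (metis e2 f2 mult.assoc)+
  have ef: "e * (f * (e * f)) = e * f" and fe: "f * (e * (f * e)) = f * e"
    using idempotents_mult_closed[OF e f] idempotents_mult_closed[OF f e]
    by (simp_all add: idempotents_def mult.assoc)
  have "sinv (e * f) = f * e"
    by (rule sinv_eqI) (simp_all add: mult.assoc e3 f3 ef fe)
  then show ?thesis
    using idempotent_sinv[OF idempotents_mult_closed[OF e f]] by simp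
qed

lemma sdom_sran_idempotent:
  fixes s :: "'a::inverse_semigroup"
  shows "sdom s \<in> idempotents" and "sran s \<in> idempotents"
  by (simp_all add: sdom_def sran_def idempotents_def mult.assoc sinv_cancel_right)

text \<open>
  In \<open>s * t * (sinv t * sinv s) * (s * t)\<close> the idempotents \<open>sran t\<close> and \<open>sdom s\<close> meet in the middle;
  after exchanging them, each is absorbed by its neighbour.
\<close>

lemma sinv_mult:
  fixes s t :: "'a::inverse_semigroup"
  shows "sinv (s * t) = sinv t * sinv s"
proof (rule sinv_eqI)
  have comm: "sran t * sdom s = sdom s * sran t"
    by (intro idempotents_commute sdom_sran_idempotent)
  have "s * t * (sinv t * sinv s) * (s * t) = s * (sran t * sdom s) * t"
    by (simp add: sdom_def sran_def mult.assoc)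
  also have "\<dots> = s * t"
    by (subst comm) (simp add: sdom_def sran_def mult.assoc sinv_cancel_right)
  finally show "s * t * (sinv t * sinv s) * (s * t) = s * t" .
  have "sinv t * sinv s * (s * t) * (sinv t * sinv s) = sinv t * (sdom s * sran t) * sinv s"
    by (simp add: sdom_def sran_def mult.assoc)
  also have "\<dots> = sinv t * sinv s"
    by (subst comm[symmetric]) (simp add: sdom_def sran_def mult.assoc sinv_cancel_right)
  finally show "sinv t * sinv s * (s * t) * (sinv t * sinv s) = sinv t * sinv s" .
qed

lemma sdom_sinv [simp]: "sdom (sinv s) = sran s" and sran_sinv [simp]: "sran (sinv s) = sdom s"
  by (simp_all add: sdom_def sran_def)

lemma sran_mult_self: "sran s * s = s" and mult_sdom_self: "s * sdom s = s"
  by (simp_all add: sdom_def sran_def mult.assoc sinv_cancel_right)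

lemma sdom_idempotent: "e \<in> idempotents \<Longrightarrow> sdom e = e"
  and sran_idempotent: "e \<in> idempotents \<Longrightarrow> sran e = e"
  by (simp_all add: sdom_def sran_def idempotent_sinv) (simp_all add: idempotents_def)

lemma sran_mult: "sdom s = sran t \<Longrightarrow> sran (s * t) = sran s"
  unfolding sran_def sdom_def sinv_mult
  by (metis mult.assoc sinv_cancel_right(1))

lemma sdom_mult: "sdom s = sran t \<Longrightarrow> sdom (s * t) = sdom t"
  unfolding sran_def sdom_def sinv_mult
  by (metis mult.assoc sinv_cancel_right(1))

lemma D_rel_sran: "(x, sran s) \<in> D_rel \<longleftrightarrow> (x, s) \<in> D_rel"
  by (simp add: D_rel_def sran_idempotent sdom_sran_idempotent)

lemma D_rel_sdom:
  assumes "(x, s) \<in> D_rel"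
  shows "(x, sdom s) \<in> D_rel"
proof -
  obtain z where "sdom z = sran x" "sran z = sran s"
    using assms by (auto simp: D_rel_def)
  then have "sdom (sinv s * z) = sran x" "sran (sinv s * z) = sran (sdom s)"
    by (simp_all add: sran_mult sdom_mult sran_idempotent sdom_sran_idempotent)
  then show ?thesis
    unfolding D_rel_def by blast
qed

lemma D_class_sran_sdom:
  assumes "C \<in> UNIV // D_rel" "s \<in> C"
  shows "sran s \<in> idempotents \<inter> C" and "sdom s \<in> idempotents \<inter> C"
  using assms by (auto simp: quotient_def sdom_sran_idempotent D_rel_sran D_rel_sdom)

subsection \<open>The natural partial order\<close>

lemma nat_le_refl: "s \<preceq> s"
  unfolding nat_le_def using sdom_sran_idempotent(2) sran_mult_self by metis

lemma nat_le_trans: "t \<preceq> u \<Longrightarrow> u \<preceq> s \<Longrightarrow> t \<preceq> s"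
  unfolding nat_le_def using idempotents_mult_closed by (metis mult.assoc)

lemma nat_le_antisym:
  assumes "t \<preceq> s" "s \<preceq> t"
  shows "t = s"
proof -
  obtain e f where e: "e \<in> idempotents" "t = e * s" and f: "f \<in> idempotents" "s = f * t"
    using assms unfolding nat_le_def by blast
  have ee: "e * e = e"
    using e by (simp add: idempotents_def)
  have "s = f * (e * s)"
    using e f by simp
  also have "\<dots> = e * (f * s)"
    using idempotents_commute[OF e(1) f(1)] by (metis mult.assoc)
  finally have "s = e * (f * s)" .
  then have "e * s = s"
    by (metis ee mult.assoc)
  with e show ?thesis by simp
qed

text \<open>
  By induction along the order: once \<open>a\<close> and \<open>b\<close> agree strictly below \<open>r\<close>, their sums over the
  elements below \<open>r\<close> differ by \<open>a r - b r\<close>. This gives the uniqueness of the Moebius function and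
  also shows that it is a two-sided inverse of the zeta function.
\<close>

lemma down_sums_determine:
  fixes a b :: "'a::{finite, inverse_semigroup} \<Rightarrow> 'b::ab_group_add"
  assumes eq: "\<And>r. (\<Sum>s | s \<preceq> r. a s) = (\<Sum>s | s \<preceq> r. b s)"
  shows "a r = b r"
proof (induction "card {s. s \<preceq> r}" arbitrary: r rule: less_induct)
  case less
  have split: "{s. s \<preceq> r} = insert r {s. s \<preceq> r \<and> s \<noteq> r}"
    using nat_le_refl by auto
  have "a s = b s" if "s \<preceq> r" "s \<noteq> r" for s
  proof (rule less.hyps)
    have "{u. u \<preceq> s} \<subset> {u. u \<preceq> r}"
    proof
      show "{u. u \<preceq> s} \<subseteq> {u. u \<preceq> r}"
        using nat_le_trans that(1) by blast
      have "\<not> r \<preceq> s"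
        using nat_le_antisym that by blast
      then show "{u. u \<preceq> s} \<noteq> {u. u \<preceq> r}"
        using nat_le_refl[of r] by blast
    qed
    then show "card {u. u \<preceq> s} < card {u. u \<preceq> r}"
      by (intro psubset_card_mono) auto
  qed
  then have "(\<Sum>s | s \<preceq> r \<and> s \<noteq> r. a s) = (\<Sum>s | s \<preceq> r \<and> s \<noteq> r. b s)"
    by (intro sum.cong) auto
  with eq[of r] show ?case
    unfolding split by simp
qed

text \<open>
  A witness for the description that defines \<open>moebius\<close>: the equation for the interval from \<open>t\<close> to
  \<open>s\<close> is solved for its last term.
\<close>

function moebius_rec :: "'a::{finite, inverse_semigroup} \<Rightarrow> 'a \<Rightarrow> int" where
  "moebius_rec t s = (if \<not> t \<preceq> s then 0 else if t = s then 1 else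
     - (\<Sum>u\<in>{u. t \<preceq> u \<and> u \<preceq> s \<and> u \<noteq> s}. moebius_rec t u))"
  by auto
termination
proof (relation "measure (\<lambda>(t, s). card {u. u \<preceq> s})")
  fix t s u :: 'a
  assume "u \<in> {u. t \<preceq> u \<and> u \<preceq> s \<and> u \<noteq> s}"
  then have "{v. v \<preceq> u} \<subset> {v. v \<preceq> s}"
    using nat_le_refl nat_le_trans nat_le_antisym by blast
  then show "((t, u), t, s) \<in> measure (\<lambda>(t, s). card {u. u \<preceq> s})"
    by (simp add: psubset_card_mono)
qed simp

declare moebius_rec.simps [simp del]

text \<open>
  A function with support in the order relation may be summed over a whole down-set instead of an
  interval. In this form the Moebius equations are accessible to \<open>down_sums_determine\<close>.
\<close>

lemma interval_sums_as_down_sum: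
  fixes \<mu> :: "'a::{finite, inverse_semigroup} \<Rightarrow> 'a \<Rightarrow> int"
  assumes sums: "\<And>t s. t \<preceq> s \<Longrightarrow> (\<Sum>u | t \<preceq> u \<and> u \<preceq> s. \<mu> t u) = (if t = s then 1 else 0)"
    and zero: "\<And>t s. \<not> t \<preceq> s \<Longrightarrow> \<mu> t s = 0"
  shows "(\<Sum>u | u \<preceq> s. \<mu> t u) = (if t = s then 1 else 0)"
proof -
  have "(\<Sum>u | u \<preceq> s. \<mu> t u) = (\<Sum>u | t \<preceq> u \<and> u \<preceq> s. \<mu> t u)"
  proof (rule sum.mono_neutral_right)
    show "\<forall>u\<in>{u. u \<preceq> s} - {u. t \<preceq> u \<and> u \<preceq> s}. \<mu> t u = 0"
      using zero by blast
  qed auto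
  also have "\<dots> = (if t = s then 1 else 0)"
  proof (cases "t \<preceq> s")
    case False
    then have "{u. t \<preceq> u \<and> u \<preceq> s} = {}" "t \<noteq> s"
      using nat_le_trans nat_le_refl by blast+
    then show ?thesis by (simp only: sum.empty if_False)
  qed (rule sums)
  finally show ?thesis .
qed

text \<open>
  The witness \<open>moebius_rec\<close> exists by recursion on down-sets, and it is unique because the defining
  equations prescribe all down-sums in the second argument.
\<close>

lemma moebius_spec:
  fixes t s :: "'a::{finite, inverse_semigroup}"
  shows "t \<preceq> s \<Longrightarrow> (\<Sum>u | t \<preceq> u \<and> u \<preceq> s. moebius t u) = (if t = s then 1 else 0)"
    and "\<not> t \<preceq> s \<Longrightarrow> moebius t s = 0"
proof -
  let ?P = "\<lambda>\<mu>::'a \<Rightarrow> 'a \<Rightarrow> int. \<forall>t s.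
     (t \<preceq> s \<longrightarrow> (\<Sum>u | t \<preceq> u \<and> u \<preceq> s. \<mu> t u) = (if t = s then 1 else 0)) \<and>
     (\<not> t \<preceq> s \<longrightarrow> \<mu> t s = 0)"
  have ex: "?P moebius_rec"
  proof (intro allI conjI impI)
    fix t s :: 'a
    assume ts: "t \<preceq> s"
    show "(\<Sum>u | t \<preceq> u \<and> u \<preceq> s. moebius_rec t u) = (if t = s then 1 else 0)"
    proof (cases "t = s")
      case True
      have "{u. s \<preceq> u \<and> u \<preceq> s} = {s}"
        using nat_le_refl nat_le_antisym by blast
      with True show ?thesis
        by (simp add: moebius_rec.simps[of s s] nat_le_refl)
    next
      case False
      have "{u. t \<preceq> u \<and> u \<preceq> s} = insert s {u. t \<preceq> u \<and> u \<preceq> s \<and> u \<noteq> s}"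
        using nat_le_refl ts by auto
      with False ts show ?thesis
        by (simp add: moebius_rec.simps[of t s])
    qed
  qed (simp add: moebius_rec.simps)
  have uniq: "\<mu> = \<nu>" if mu: "?P \<mu>" and nu: "?P \<nu>" for \<mu> \<nu>
  proof (intro ext)
    fix t s :: 'a
    have down: "(\<Sum>u | u \<preceq> r. \<kappa> t u) = (if t = r then 1 else 0)" if "?P \<kappa>" for \<kappa> r
      by (rule interval_sums_as_down_sum) (use that in blast)+
    show "\<mu> t s = \<nu> t s"
      using down_sums_determine[of "\<mu> t" "\<nu> t" s] by (simp add: down[OF mu] down[OF nu])
  qed
  have "?P moebius"
    unfolding moebius_def by (rule theI[of ?P, OF ex]) (rule uniq[OF _ ex])
  then show "t \<preceq> s \<Longrightarrow> (\<Sum>u | t \<preceq> u \<and> u \<preceq> s. moebius t u) = (if t = s then 1 else 0)"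
    and "\<not> t \<preceq> s \<Longrightarrow> moebius t s = 0" by blast+
qed

lemmas moebius_down_sum = interval_sums_as_down_sum[OF moebius_spec]

text \<open>
  The defining equation makes the Moebius matrix a left inverse of the zeta matrix; that it is
  also a right inverse follows because both sides below have the same down-sums in \<open>s\<close>.
\<close>

lemma moebius_up_sum:
  fixes t s :: "'a::{finite, inverse_semigroup}"
  shows "(\<Sum>u | t \<preceq> u. moebius u s) = (if t = s then 1 else 0)"
proof (rule down_sums_determine[where r = s])
  fix r :: 'a
  have "(\<Sum>s | s \<preceq> r. \<Sum>u | t \<preceq> u. moebius u s) = (\<Sum>u | t \<preceq> u. \<Sum>s | s \<preceq> r. moebius u s)"
    by (rule sum.swap)
  also have "\<dots> = (\<Sum>s | s \<preceq> r. if t = s then 1 else 0)"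
    by (simp add: moebius_down_sum)
  finally show "(\<Sum>s | s \<preceq> r. \<Sum>u | t \<preceq> u. moebius u s) = (\<Sum>s | s \<preceq> r. if t = s then 1 else 0)" .
qed

lemma groupoid_basis_eq:
  fixes s x :: "'a::{finite, inverse_semigroup}"
  shows "groupoid_basis s x = of_int (moebius x s)"
proof (cases "x \<preceq> s")
  case True
  then show ?thesis
    by (simp add: groupoid_basis_def single_def if_distrib cong: if_cong)
next
  case False
  then show ?thesis
    by (simp add: groupoid_basis_def single_def moebius_spec(2) if_distrib cong: if_cong)
qed

text \<open>
  Moebius inversion says \<open>single s = (\<Sum>t | t \<preceq> s. groupoid_basis t)\<close>; collecting the coefficient
  of each basis element gives the coordinates of \<open>f\<close>. So the groupoid basis spans.
\<close>

lemma groupoid_basis_coordinates: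
  fixes f :: "'a::{finite, inverse_semigroup} alg"
  shows "f = (\<lambda>x. \<Sum>t\<in>UNIV. (\<Sum>s | t \<preceq> s. f s) * groupoid_basis t x)"
proof
  fix x
  have "(\<Sum>t\<in>UNIV. (\<Sum>s | t \<preceq> s. f s) * groupoid_basis t x)
      = (\<Sum>t\<in>UNIV. \<Sum>s\<in>UNIV. if t \<preceq> s then f s * groupoid_basis t x else 0)"
    by (simp add: sum_distrib_right sum.If_cases)
  also have "\<dots> = (\<Sum>s\<in>UNIV. \<Sum>t\<in>UNIV. if t \<preceq> s then f s * groupoid_basis t x else 0)"
    by (rule sum.swap)
  also have "\<dots> = (\<Sum>s\<in>UNIV. f s * of_int (\<Sum>t | t \<preceq> s. moebius x t))"
    by (simp add: sum_distrib_left sum.If_cases groupoid_basis_eq)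
  also have "\<dots> = f x"
    by (simp add: moebius_down_sum if_distrib cong: if_cong)
  finally show "f x = (\<Sum>t\<in>UNIV. (\<Sum>s | t \<preceq> s. f s) * groupoid_basis t x)" ..
qed

text \<open>
  The coordinates found in \<open>groupoid_basis_coordinates\<close> are dual to the groupoid basis, so the basis
  elements are independent.
\<close>

lemma groupoid_basis_up_sum:
  fixes s t :: "'a::{finite, inverse_semigroup}"
  shows "(\<Sum>u | t \<preceq> u. groupoid_basis s u) = (if t = s then 1 else 0)"
proof -
  have "(\<Sum>u | t \<preceq> u. groupoid_basis s u) = of_int (\<Sum>u | t \<preceq> u. moebius u s)"
    by (simp add: groupoid_basis_eq)
  then show ?thesis by (simp add: moebius_up_sum)
qed

section \<open>Linear maps into matrices\<close>

lemma alg_on_zero: "(\<lambda>_. 0) \<in> alg_on A"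
  and alg_on_add: "f \<in> alg_on A \<Longrightarrow> g \<in> alg_on A \<Longrightarrow> (\<lambda>x. f x + g x) \<in> alg_on A"
  and alg_on_scale: "f \<in> alg_on A \<Longrightarrow> (\<lambda>x. k * f x) \<in> alg_on A"
  and alg_on_single: "x \<in> A \<Longrightarrow> single x \<in> alg_on A"
  and alg_on_sum: "(\<And>t. t \<in> T \<Longrightarrow> b t \<in> alg_on A) \<Longrightarrow> (\<lambda>x. \<Sum>t\<in>T. c t * b t x) \<in> alg_on A"
  by (auto simp: alg_on_def single_def intro!: sum.neutral)

lemma linear_to_matD:
  assumes "linear_to_mat A d R"
  shows "f \<in> A \<Longrightarrow> R f \<in> carrier_mat d d"
    and "f \<in> A \<Longrightarrow> g \<in> A \<Longrightarrow> R (\<lambda>x. f x + g x) = R f + R g"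
    and "f \<in> A \<Longrightarrow> R (\<lambda>x. c * f x) = c \<cdot>\<^sub>m R f"
  using assms by (simp_all add: linear_to_mat_def)

text \<open>
  Matrices of variable size do not form a monoid type, so linearity over finite sums is expressed
  for each matrix entry.
\<close>

lemma linear_to_mat_sum:
  assumes R: "linear_to_mat (alg_on A) d R" and "finite T"
    and b: "\<And>t. t \<in> T \<Longrightarrow> b t \<in> alg_on A" and ij: "i < d" "j < d"
  shows "R (\<lambda>x. \<Sum>t\<in>T. c t * b t x) $$ (i, j) = (\<Sum>t\<in>T. c t * R (b t) $$ (i, j))"
  using \<open>finite T\<close> b
proof (induction T)
  case empty
  have "R (\<lambda>_. 0) = 0 \<cdot>\<^sub>m R (\<lambda>_. 0)"
    using linear_to_matD(3)[OF R alg_on_zero, of 0] by simp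
  moreover have "R (\<lambda>_. 0) \<in> carrier_mat d d"
    by (rule linear_to_matD(1)[OF R alg_on_zero])
  ultimately have "R (\<lambda>_. 0) $$ (i, j) = 0"
    using ij by (metis carrier_matD index_smult_mat(1) mult_zero_left)
  then show ?case by simp
next
  case (insert t T)
  let ?f = "\<lambda>x. c t * b t x" and ?g = "\<lambda>x. \<Sum>t\<in>T. c t * b t x"
  have f: "?f \<in> alg_on A" and g: "?g \<in> alg_on A" and bt: "b t \<in> alg_on A"
    using insert.prems alg_on_scale[of "b t"] alg_on_sum[of T b A c] by auto
  have "R (\<lambda>x. ?f x + ?g x) = c t \<cdot>\<^sub>m R (b t) + R ?g"
  proof -
    note linear_to_matD(2)[OF R f g]
    also note linear_to_matD(3)[OF R bt]
    finally show ?thesis .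
  qed
  moreover have "R (b t) \<in> carrier_mat d d" "R ?g \<in> carrier_mat d d"
    using linear_to_matD(1)[OF R] bt g by blast+
  ultimately have "R (\<lambda>x. ?f x + ?g x) $$ (i, j) = c t * R (b t) $$ (i, j) + R ?g $$ (i, j)"
    using ij by simp
  moreover have "R ?g $$ (i, j) = (\<Sum>t\<in>T. c t * R (b t) $$ (i, j))"
    using insert by blast
  ultimately show ?case
    using insert.hyps by simp
qed

lemma alg_on_expand:
  fixes f :: "'a::finite alg"
  assumes "f \<in> alg_on A"
  shows "f = (\<lambda>y. \<Sum>x\<in>A. f x * single x y)"
  using assms by (auto simp: alg_on_def single_def if_distrib cong: if_cong)

lemma linear_to_mat_expand:
  fixes f :: "'a::finite alg"
  assumes R: "linear_to_mat (alg_on A) d R" and f: "f \<in> alg_on A" and ij: "i < d" "j < d"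
  shows "R f $$ (i, j) = (\<Sum>x\<in>A. f x * R (single x) $$ (i, j))"
  using linear_to_mat_sum[OF R _ _ ij, of A single f]
  by (simp add: alg_on_single flip: alg_on_expand[OF f])

lemma ex1_linear_on_groupoid_basis:
  fixes M :: "'a::{finite, inverse_semigroup} \<Rightarrow> complex mat"
  assumes M: "\<And>s. M s \<in> carrier_mat d d"
  shows "\<exists>!R. linear_to_mat (alg_on UNIV) d R \<and> (\<forall>s. R (groupoid_basis s) = M s)"
proof (rule ex_ex1I)
  let ?R = "\<lambda>f. mat d d (\<lambda>ij. \<Sum>t\<in>UNIV. (\<Sum>s | t \<preceq> s. f s) * M t $$ ij)"
  have "linear_to_mat (alg_on UNIV) d ?R"
    unfolding linear_to_mat_def
    by (auto intro!: eq_matI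
             simp: sum.distrib distrib_right mult.assoc simp flip: sum_distrib_left)
  moreover have "?R (groupoid_basis s) = M s" for s
    using M[of s] by (auto intro!: eq_matI simp: groupoid_basis_up_sum if_distrib[where f = "\<lambda>z. z * _"] cong: if_cong)
  ultimately show "\<exists>R. linear_to_mat (alg_on UNIV) d R \<and> (\<forall>s. R (groupoid_basis s) = M s)"
    by blast
next
  fix R R' :: "'a alg \<Rightarrow> complex mat"
  assume R: "linear_to_mat (alg_on UNIV) d R \<and> (\<forall>s. R (groupoid_basis s) = M s)"
    and R': "linear_to_mat (alg_on UNIV) d R' \<and> (\<forall>s. R' (groupoid_basis s) = M s)"
  have univ: "f \<in> alg_on UNIV" for f :: "'a alg"
    by (simp add: alg_on_def)
  show "R = R'"
  proof
    fix f
    have carr: "R f \<in> carrier_mat d d" "R' f \<in> carrier_mat d d"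
      using R R' univ[of f] unfolding linear_to_mat_def by blast+
    show "R f = R' f"
    proof (rule eq_matI)
      fix i j
      assume "i < dim_row (R' f)" "j < dim_col (R' f)"
      then have ij: "i < d" "j < d" using carr by auto
      show "R f $$ (i, j) = R' f $$ (i, j)"
        using R R' linear_to_mat_sum[OF _ _ univ ij, of R UNIV "\<lambda>t. \<Sum>s | t \<preceq> s. f s" groupoid_basis]
          linear_to_mat_sum[OF _ _ univ ij, of R' UNIV "\<lambda>t. \<Sum>s | t \<preceq> s. f s" groupoid_basis]
        by (simp flip: groupoid_basis_coordinates)
    qed (use carr in auto)
  qed
qed

section \<open>Matrices\<close>

lemma mat_mult_entry:
  assumes "A \<in> carrier_mat n m" "B \<in> carrier_mat m k" "i < n" "j < k"
  shows "(A * B) $$ (i, j) = (\<Sum>l<m. A $$ (i, l) * B $$ (l, j))"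
  using assms by (auto simp: scalar_prod_def lessThan_atLeast0)

lemma mat_trace_mult_commute:
  assumes A: "A \<in> carrier_mat n m" and B: "B \<in> carrier_mat m n"
  shows "mat_trace (A * B) = mat_trace (B * A)"
proof -
  have "mat_trace (A * B) = (\<Sum>i<n. \<Sum>l<m. A $$ (i, l) * B $$ (l, i))"
    using A mat_mult_entry[OF A B] unfolding mat_trace_def by (auto intro!: sum.cong)
  also have "\<dots> = (\<Sum>l<m. \<Sum>i<n. B $$ (l, i) * A $$ (i, l))"
    by (subst sum.swap) (simp add: mult.commute)
  also have "\<dots> = mat_trace (B * A)"
    using B mat_mult_entry[OF B A] unfolding mat_trace_def by (auto intro!: sum.cong)
  finally show ?thesis .
qed

lemma mat_trace_one: "mat_trace (1\<^sub>m n) = of_nat n"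
  by (simp add: mat_trace_def)

lemma mult_mat_unit_vec:
  fixes A :: "complex mat"
  assumes A: "A \<in> carrier_mat n m" and j: "j < m"
  shows "A *\<^sub>v unit_vec m j = col A j"
  using A j by (intro eq_vecI) auto

lemma mat_eq_iff_mult_vec:
  fixes A B :: "complex mat"
  assumes A: "A \<in> carrier_mat n m" and B: "B \<in> carrier_mat n m"
    and eq: "\<And>v. v \<in> carrier_vec m \<Longrightarrow> A *\<^sub>v v = B *\<^sub>v v"
  shows "A = B"
proof (rule eq_matI)
  fix i j
  assume "i < dim_row B" "j < dim_col B"
  then have i: "i < n" and j: "j < m" using B by auto
  have "col A j = col B j"
    using eq[of "unit_vec m j"] j by (simp add: mult_mat_unit_vec[OF A] mult_mat_unit_vec[OF B])
  then have "col A j $ i = col B j $ i" by simp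
  then show "A $$ (i, j) = B $$ (i, j)"
    using A B i j by simp
qed (use A B in auto)

lemma subspace_module_vec_iff:
  "VectorSpace.subspace class_ring W (module_vec TYPE(complex) n) \<longleftrightarrow>
     W \<subseteq> carrier_vec n \<and> 0\<^sub>v n \<in> W \<and> (\<forall>v\<in>W. \<forall>w\<in>W. v + w \<in> W) \<and> (\<forall>c. \<forall>v\<in>W. c \<cdot>\<^sub>v v \<in> W)"
  using vec_vs[of n, where 'a = complex] vec_module[of n, where 'a = complex]
  by (auto simp: VectorSpace.subspace_def submodule_def module_vec_simps class_ring_simps)

section \<open>Irreducible representations of a finite group\<close>

subsection \<open>Schur's lemma\<close>

lemma irreducible_repD:
  assumes "irreducible_rep H e \<rho>"
  shows "representation H e (rep_dim \<rho>) \<rho>" and "rep_dim \<rho> > 0"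
    and "f \<in> alg_on H \<Longrightarrow> \<rho> f \<in> carrier_mat (rep_dim \<rho>) (rep_dim \<rho>)"
    and "linear_to_mat (alg_on H) (rep_dim \<rho>) \<rho>"
  using assms by (auto simp: irreducible_rep_def representation_def linear_to_mat_def)

lemma irreducible_rep_subspace_cases:
  assumes irr: "irreducible_rep H e \<rho>"
    and "W \<subseteq> carrier_vec (rep_dim \<rho>)" "0\<^sub>v (rep_dim \<rho>) \<in> W"
    and "\<And>v w. v \<in> W \<Longrightarrow> w \<in> W \<Longrightarrow> v + w \<in> W" "\<And>c v. v \<in> W \<Longrightarrow> c \<cdot>\<^sub>v v \<in> W"
    and "\<And>f v. f \<in> alg_on H \<Longrightarrow> v \<in> W \<Longrightarrow> \<rho> f *\<^sub>v v \<in> W"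
  obtains "W = {0\<^sub>v (rep_dim \<rho>)}" | "W = carrier_vec (rep_dim \<rho>)"
proof -
  have "VectorSpace.subspace class_ring W (module_vec TYPE(complex) (rep_dim \<rho>))"
    unfolding subspace_module_vec_iff using assms(2-5) by simp
  moreover have "\<forall>f\<in>alg_on H. \<forall>w\<in>W. \<rho> f *\<^sub>v w \<in> W"
    using assms(6) by simp
  ultimately have "W = {0\<^sub>v (rep_dim \<rho>)} \<or> W = carrier_vec (rep_dim \<rho>)"
    using irr unfolding irreducible_rep_def by simp
  with that show thesis by metis
qed

text \<open>
  The first half of Schur's lemma. The kernel of \<open>T\<close> is an invariant subspace for \<open>\<sigma>\<close> and the image
  one for \<open>\<rho>\<close>, so \<open>T\<close> is bijective on vectors. That the two dimensions agree follows by comparing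
  the traces of \<open>T * S\<close> and \<open>S * T\<close> for the inverse \<open>S\<close>.
\<close>

lemma intertwiner_imp_equivalent:
  assumes \<rho>: "irreducible_rep H e \<rho>" and \<sigma>: "irreducible_rep H e \<sigma>"
    and T: "T \<in> carrier_mat (rep_dim \<rho>) (rep_dim \<sigma>)"
    and comm: "\<And>f. f \<in> alg_on H \<Longrightarrow> \<rho> f * T = T * \<sigma> f"
    and nonzero: "T \<noteq> 0\<^sub>m (rep_dim \<rho>) (rep_dim \<sigma>)"
  shows "equivalent_reps H \<rho> \<sigma>"
proof -
  let ?m = "rep_dim \<rho>" and ?n = "rep_dim \<sigma>"
  note carr = irreducible_repD(3)[OF \<rho>] irreducible_repD(3)[OF \<sigma>]
  have comm_vec: "\<rho> f *\<^sub>v (T *\<^sub>v v) = T *\<^sub>v (\<sigma> f *\<^sub>v v)"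
    if "f \<in> alg_on H" "v \<in> carrier_vec ?n" for f v
    using comm[OF that(1)] carr[OF that(1)] T that(2)
    by (metis assoc_mult_mat_vec)
  have ex_nz: "\<exists>v\<in>carrier_vec ?n. T *\<^sub>v v \<noteq> 0\<^sub>v ?m"
  proof (rule ccontr)
    assume "\<not> ?thesis"
    then have "T = 0\<^sub>m ?m ?n"
      by (intro mat_eq_iff_mult_vec[OF T]) auto
    with nonzero show False by simp
  qed
  define K where "K = {v \<in> carrier_vec ?n. T *\<^sub>v v = 0\<^sub>v ?m}"
  have "K = {0\<^sub>v ?n}"
  proof (rule irreducible_rep_subspace_cases[OF \<sigma>, of K])
    show "K \<subseteq> carrier_vec ?n" "0\<^sub>v ?n \<in> K"
      using T by (auto simp: K_def)
    show "v + w \<in> K" if "v \<in> K" "w \<in> K" for v w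
      using that T by (auto simp: K_def mult_add_distrib_mat_vec[OF T])
    show "c \<cdot>\<^sub>v v \<in> K" if "v \<in> K" for c v
      using that T by (auto simp: K_def mult_mat_vec[OF T])
    show "\<sigma> f *\<^sub>v v \<in> K" if "f \<in> alg_on H" "v \<in> K" for f v
    proof -
      have "\<rho> f *\<^sub>v 0\<^sub>v ?m = 0\<^sub>v ?m"
        using carr[OF that(1)] by (intro eq_vecI) auto
      then show ?thesis
        using that carr[OF that(1)] comm_vec[OF that(1), of v] by (auto simp: K_def)
    qed
    assume "K = carrier_vec ?n"
    then show ?thesis using ex_nz by (auto simp: K_def)
  qed
  define I where "I = (\<lambda>v. T *\<^sub>v v) ` carrier_vec ?n"
  have "I = carrier_vec ?m"
  proof (rule irreducible_rep_subspace_cases[OF \<rho>, of I])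
    show "I \<subseteq> carrier_vec ?m"
      using T by (auto simp: I_def)
    show "0\<^sub>v ?m \<in> I"
      unfolding I_def using T by (intro image_eqI[of _ _ "0\<^sub>v ?n"]) auto
    show "v + w \<in> I" if vw: "v \<in> I" "w \<in> I" for v w
    proof -
      obtain v' w' where "v' \<in> carrier_vec ?n" "w' \<in> carrier_vec ?n" "v = T *\<^sub>v v'" "w = T *\<^sub>v w'"
        using vw unfolding I_def by blast
      then show ?thesis
        unfolding I_def by (intro image_eqI[of _ _ "v' + w'"]) (auto simp: mult_add_distrib_mat_vec[OF T])
    qed
    show "c \<cdot>\<^sub>v v \<in> I" if v: "v \<in> I" for c v
    proof -
      obtain v' where "v' \<in> carrier_vec ?n" "v = T *\<^sub>v v'"
        using v unfolding I_def by blast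
      then show ?thesis
        unfolding I_def by (intro image_eqI[of _ _ "c \<cdot>\<^sub>v v'"]) (auto simp: mult_mat_vec[OF T])
    qed
    show "\<rho> f *\<^sub>v v \<in> I" if f: "f \<in> alg_on H" and v: "v \<in> I" for f v
    proof -
      obtain v' where "v' \<in> carrier_vec ?n" "v = T *\<^sub>v v'"
        using v unfolding I_def by blast
      then show ?thesis
        unfolding I_def using carr[OF f] comm_vec[OF f]
        by (intro image_eqI[of _ _ "\<sigma> f *\<^sub>v v'"]) auto
    qed
    assume "I = {0\<^sub>v ?m}"
    then show ?thesis using ex_nz by (auto simp: I_def)
  qed
  \<comment> \<open>a right inverse of \<open>T\<close>, whose columns are preimages of the unit vectors\<close>
  then have "\<forall>j<?m. \<exists>v. v \<in> carrier_vec ?n \<and> T *\<^sub>v v = unit_vec ?m j"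
    unfolding I_def by (metis imageE unit_vec_carrier)
  then obtain c where c: "\<And>j. j < ?m \<Longrightarrow> c j \<in> carrier_vec ?n \<and> T *\<^sub>v c j = unit_vec ?m j"
    by metis
  define S where "S = mat ?n ?m (\<lambda>(i, j). c j $ i)"
  have S: "S \<in> carrier_mat ?n ?m"
    by (simp add: S_def)
  have TS: "T * S = 1\<^sub>m ?m"
  proof (rule eq_matI)
    fix i j
    assume "i < dim_row (1\<^sub>m ?m :: complex mat)" "j < dim_col (1\<^sub>m ?m :: complex mat)"
    then have i: "i < ?m" and j: "j < ?m" by auto
    have "col S j = c j"
      using c[OF j] j by (intro eq_vecI) (auto simp: S_def)
    then have "(T * S) $$ (i, j) = (T *\<^sub>v c j) $ i"
      using T S i j by simp
    then show "(T * S) $$ (i, j) = 1\<^sub>m ?m $$ (i, j)"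
      using c[OF j] i j by simp
  qed (use T S in auto)
  have ST: "S * T = 1\<^sub>m ?n"
  proof (rule mat_eq_iff_mult_vec)
    show "S * T \<in> carrier_mat ?n ?n" using S T by simp
    fix v :: "complex vec"
    assume v: "v \<in> carrier_vec ?n"
    define w where "w = (S * T) *\<^sub>v v - v"
    have STv: "(S * T) *\<^sub>v v \<in> carrier_vec ?n" using S T v by simp
    have "T *\<^sub>v ((S * T) *\<^sub>v v) = (T * S) *\<^sub>v (T *\<^sub>v v)"
      using S T v by (simp add: assoc_mult_mat_vec[OF S T] assoc_mult_mat_vec[OF T S])
    also have "\<dots> = T *\<^sub>v v"
      using T v TS by simp
    finally have "T *\<^sub>v w = 0\<^sub>v ?m"
      unfolding w_def using T v by (simp add: mult_minus_distrib_mat_vec[OF T STv v])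
    moreover have "w \<in> carrier_vec ?n"
      unfolding w_def using v STv by simp
    ultimately have "w \<in> K"
      by (simp add: K_def)
    then have "w = 0\<^sub>v ?n"
      by (simp add: \<open>K = {0\<^sub>v ?n}\<close>)
    show "(S * T) *\<^sub>v v = 1\<^sub>m ?n *\<^sub>v v"
    proof (rule eq_vecI)
      fix i
      assume "i < dim_vec (1\<^sub>m ?n *\<^sub>v v)"
      then have "i < ?n" using v by simp
      then have "w $ i = 0" using \<open>w = 0\<^sub>v ?n\<close> by simp
      then show "((S * T) *\<^sub>v v) $ i = (1\<^sub>m ?n *\<^sub>v v) $ i"
        using \<open>i < ?n\<close> STv v by (simp add: w_def)
    qed (use STv v S in auto)
  qed simp
  have dims: "?m = ?n"
    using mat_trace_mult_commute[OF T S] by (simp add: TS ST mat_trace_one)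
  have "similar_mat_wit (\<rho> f) (\<sigma> f) T S" if f: "f \<in> alg_on H" for f
  proof -
    have "\<rho> f = \<rho> f * (T * S)"
      using carr(1)[OF f] by (simp add: TS)
    also have "\<dots> = \<rho> f * T * S"
      by (rule assoc_mult_mat[OF carr(1)[OF f] T S, symmetric])
    also have "\<dots> = T * \<sigma> f * S"
      by (simp only: comm[OF f])
    finally have factor: "\<rho> f = T * \<sigma> f * S" .
    have "{\<rho> f, \<sigma> f, T, S} \<subseteq> carrier_mat ?m ?m" and "dim_row (\<rho> f) = ?m"
      using carr[OF f] T S by (auto simp: dims)
    with factor TS ST show ?thesis
      unfolding similar_mat_wit_def Let_def by (simp only: dims simp_thms)
  qed
  then show ?thesis
    unfolding equivalent_reps_def by blast
qed

text \<open>
  The second half of Schur's lemma: \<open>T\<close> has an eigenvalue over the complex numbers, and the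
  corresponding eigenspace is an invariant subspace, hence everything.
\<close>

lemma self_intertwiner_scalar:
  assumes \<rho>: "irreducible_rep H e \<rho>"
    and T: "T \<in> carrier_mat (rep_dim \<rho>) (rep_dim \<rho>)"
    and comm: "\<And>f. f \<in> alg_on H \<Longrightarrow> \<rho> f * T = T * \<rho> f"
  obtains c where "T = c \<cdot>\<^sub>m 1\<^sub>m (rep_dim \<rho>)"
proof -
  let ?n = "rep_dim \<rho>"
  note carr = irreducible_repD(3)[OF \<rho>]
  obtain c v where v: "v \<in> carrier_vec ?n" "v \<noteq> 0\<^sub>v ?n" "T *\<^sub>v v = c \<cdot>\<^sub>v v"
    using spectrum_non_empty[OF T irreducible_repD(2)[OF \<rho>]] T
    by (auto simp: spectrum_def eigenvalue_def eigenvector_def)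
  define W where "W = {v \<in> carrier_vec ?n. T *\<^sub>v v = c \<cdot>\<^sub>v v}"
  have "W = carrier_vec ?n"
  proof (rule irreducible_rep_subspace_cases[OF \<rho>, of W])
    show "W \<subseteq> carrier_vec ?n" "0\<^sub>v ?n \<in> W"
      using T by (auto simp: W_def)
    show "v + w \<in> W" if "v \<in> W" "w \<in> W" for v w
      using that T by (auto simp: W_def mult_add_distrib_mat_vec[OF T] smult_add_distrib_vec)
    show "a \<cdot>\<^sub>v v \<in> W" if "v \<in> W" for a v
      using that T by (auto simp: W_def mult_mat_vec[OF T] smult_smult_assoc mult.commute)
    show "\<rho> f *\<^sub>v v \<in> W" if f: "f \<in> alg_on H" and "v \<in> W" for f v
    proof -
      have v: "v \<in> carrier_vec ?n" "T *\<^sub>v v = c \<cdot>\<^sub>v v"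
        using that by (auto simp: W_def)
      have "T *\<^sub>v (\<rho> f *\<^sub>v v) = \<rho> f *\<^sub>v (T *\<^sub>v v)"
        using comm[OF f] carr[OF f] T v(1) by (metis assoc_mult_mat_vec)
      then show ?thesis
        using v carr[OF f] by (simp add: W_def mult_mat_vec[OF carr[OF f]])
    qed
    assume "W = {0\<^sub>v ?n}"
    then show ?thesis using v by (auto simp: W_def)
  qed
  have "T = c \<cdot>\<^sub>m 1\<^sub>m ?n"
  proof (rule mat_eq_iff_mult_vec[OF T])
    fix w :: "complex vec"
    assume w: "w \<in> carrier_vec ?n"
    then have "T *\<^sub>v w = c \<cdot>\<^sub>v w"
      using \<open>W = carrier_vec ?n\<close> by (auto simp: W_def)
    also have "\<dots> = (c \<cdot>\<^sub>m 1\<^sub>m ?n) *\<^sub>v w"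
      using w by (intro eq_vecI) auto
    finally show "T *\<^sub>v w = (c \<cdot>\<^sub>m 1\<^sub>m ?n) *\<^sub>v w" .
  qed simp
  then show thesis by (rule that)
qed

subsection \<open>Orthogonality of matrix coefficients\<close>

lemma conv_single: "conv (single x) (single y) = single (x * y)"
proof
  fix z
  have "conv (single x) (single y) z = (\<Sum>p | fst p * snd p = z. if p = (x, y) then 1 else 0)"
    unfolding conv_def single_def by (intro sum.cong) (auto split: prod.splits)
  also have "\<dots> = single (x * y) z"
    by (auto simp: single_def)
  finally show "conv (single x) (single y) z = single (x * y) z" .
qed

text \<open>
  The group shares its multiplication with an ambient semigroup, whose identity (if any) may differ
  from \<open>e\<close>: this is the situation of the maximal subgroups of an inverse semigroup.
\<close>

locale finite_group_in_semigroup =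
  fixes H :: "'a::{finite, semigroup_mult} set" and e :: 'a and iv :: "'a \<Rightarrow> 'a"
  assumes mult_closed: "x \<in> H \<Longrightarrow> y \<in> H \<Longrightarrow> x * y \<in> H"
    and e_closed: "e \<in> H"
    and inv_closed: "x \<in> H \<Longrightarrow> iv x \<in> H"
    and e_left: "x \<in> H \<Longrightarrow> e * x = x"
    and e_right: "x \<in> H \<Longrightarrow> x * e = x"
    and inv_left: "x \<in> H \<Longrightarrow> iv x * x = e"
    and inv_right: "x \<in> H \<Longrightarrow> x * iv x = e"
begin

lemma inv_mult_cancel: "x \<in> H \<Longrightarrow> y \<in> H \<Longrightarrow> iv x * (x * y) = y"
  and mult_inv_cancel: "x \<in> H \<Longrightarrow> y \<in> H \<Longrightarrow> x * (iv x * y) = y"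
  by (metis mult.assoc inv_left inv_right e_left)+

lemma mult_right_cancel_inv: "x \<in> H \<Longrightarrow> y \<in> H \<Longrightarrow> x * y * iv y = x"
  and mult_inv_right_cancel: "x \<in> H \<Longrightarrow> y \<in> H \<Longrightarrow> x * iv y * y = x"
  by (metis mult.assoc inv_left inv_right e_right)+

lemma inv_eqI: "x \<in> H \<Longrightarrow> y \<in> H \<Longrightarrow> x * y = e \<Longrightarrow> iv x = y"
  by (metis inv_mult_cancel e_right inv_closed)

lemma inv_inv: "x \<in> H \<Longrightarrow> iv (iv x) = x"
  by (rule inv_eqI) (auto simp: inv_closed inv_left)

lemma inv_mult: "x \<in> H \<Longrightarrow> y \<in> H \<Longrightarrow> iv (x * y) = iv y * iv x"
  by (rule inv_eqI) (simp_all add: mult_closed inv_closed mult.assoc mult_inv_cancel inv_right)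

lemma inv_e: "iv e = e"
  by (rule inv_eqI) (simp_all add: e_closed e_left)

lemma sum_translate_right: "y \<in> H \<Longrightarrow> (\<Sum>x\<in>H. f (x * y)) = (\<Sum>x\<in>H. f x)"
  by (rule sum.reindex_bij_witness[of _ "\<lambda>x. x * iv y" "\<lambda>x. x * y"])
     (auto simp: mult_closed inv_closed mult_right_cancel_inv mult_inv_right_cancel)

lemma sum_translate_left: "y \<in> H \<Longrightarrow> (\<Sum>x\<in>H. f (y * x)) = (\<Sum>x\<in>H. f x)"
  by (rule sum.reindex_bij_witness[of _ "\<lambda>x. iv y * x" "\<lambda>x. y * x"])
     (auto simp: mult_closed inv_closed inv_mult_cancel mult_inv_cancel)

lemma representation_mult_entry:
  assumes \<rho>: "representation H e d \<rho>" and "x \<in> H" "y \<in> H" "i < d" "j < d"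
  shows "\<rho> (single (x * y)) $$ (i, j) = (\<Sum>m<d. \<rho> (single x) $$ (i, m) * \<rho> (single y) $$ (m, j))"
proof -
  have carr: "\<rho> (single z) \<in> carrier_mat d d" if "z \<in> H" for z
    using \<rho> alg_on_single[OF that] by (auto simp: representation_def linear_to_mat_def)
  have "\<rho> (single (x * y)) = \<rho> (single x) * \<rho> (single y)"
    using \<rho> assms(2,3) alg_on_single by (metis representation_def conv_single)
  then show ?thesis
    using mat_mult_entry[OF carr carr] assms by simp
qed

lemma representation_e_entry:
  assumes "representation H e d \<rho>" "i < d" "j < d"
  shows "\<rho> (single e) $$ (i, j) = (if i = j then 1 else 0)"
  using assms by (simp add: representation_def)

text \<open>
  Averaging the matrix unit \<open>E\<close> with entry \<open>1\<close> at \<open>(j, k)\<close> over the group, \<open>T\<close> being the sum of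
  \<open>\<rho> (iv x) * E * \<sigma> x\<close>, gives an intertwiner; its entries are the inner products of matrix
  coefficients that the orthogonality relations are about.
\<close>

lemma averaged_intertwiner:
  assumes \<rho>: "representation H e d \<rho>" and \<sigma>: "representation H e d' \<sigma>"
    and j: "j < d" and k: "k < d'" and f: "f \<in> alg_on H"
  defines "T \<equiv> mat d d' (\<lambda>(i, l). \<Sum>x\<in>H. \<rho> (single (iv x)) $$ (i, j) * \<sigma> (single x) $$ (k, l))"
  shows "\<rho> f * T = T * \<sigma> f"
proof (rule eq_matI)
  have lin: "linear_to_mat (alg_on H) d \<rho>" "linear_to_mat (alg_on H) d' \<sigma>"
    using \<rho> \<sigma> by (auto simp: representation_def)
  have carr: "\<rho> f \<in> carrier_mat d d" "\<sigma> f \<in> carrier_mat d' d'" "T \<in> carrier_mat d d'"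
    using lin f by (auto simp: linear_to_mat_def T_def)
  then show "dim_row (\<rho> f * T) = dim_row (T * \<sigma> f)" "dim_col (\<rho> f * T) = dim_col (T * \<sigma> f)"
    by auto
  fix i l
  assume "i < dim_row (T * \<sigma> f)" "l < dim_col (T * \<sigma> f)"
  then have i: "i < d" and l: "l < d'"
    using carr by auto
  have move: "(\<Sum>m<d. \<rho> (single y) $$ (i, m) * T $$ (m, l)) = (\<Sum>m<d'. T $$ (i, m) * \<sigma> (single y) $$ (m, l))"
    if y: "y \<in> H" for y
  proof -
    have "(\<Sum>m<d. \<rho> (single y) $$ (i, m) * T $$ (m, l))
        = (\<Sum>x\<in>H. (\<Sum>m<d. \<rho> (single y) $$ (i, m) * \<rho> (single (iv x)) $$ (m, j)) * \<sigma> (single x) $$ (k, l))"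
      using l by (simp add: T_def sum_distrib_left sum_distrib_right mult.assoc) (rule sum.swap)
    also have "\<dots> = (\<Sum>x\<in>H. \<rho> (single (y * iv x)) $$ (i, j) * \<sigma> (single x) $$ (k, l))"
      using y i j by (simp add: representation_mult_entry[OF \<rho>] inv_closed)
    also have "\<dots> = (\<Sum>x\<in>H. \<rho> (single (y * iv (x * y))) $$ (i, j) * \<sigma> (single (x * y)) $$ (k, l))"
      by (rule sum_translate_right[OF y, symmetric])
    also have "\<dots> = (\<Sum>x\<in>H. \<rho> (single (iv x)) $$ (i, j) * \<sigma> (single (x * y)) $$ (k, l))"
      using y by (intro sum.cong) (simp_all add: inv_mult inv_closed mult_inv_cancel)
    also have "\<dots> = (\<Sum>x\<in>H. \<Sum>m<d'. \<rho> (single (iv x)) $$ (i, j) * \<sigma> (single x) $$ (k, m) * \<sigma> (single y) $$ (m, l))"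
      using y k l by (simp add: representation_mult_entry[OF \<sigma>] sum_distrib_left mult.assoc)
    also have "\<dots> = (\<Sum>m<d'. \<Sum>x\<in>H. \<rho> (single (iv x)) $$ (i, j) * \<sigma> (single x) $$ (k, m) * \<sigma> (single y) $$ (m, l))"
      by (rule sum.swap)
    also have "\<dots> = (\<Sum>m<d'. T $$ (i, m) * \<sigma> (single y) $$ (m, l))"
      using i by (simp add: T_def sum_distrib_right)
    finally show ?thesis .
  qed
  have "(\<rho> f * T) $$ (i, l) = (\<Sum>m<d. \<Sum>y\<in>H. f y * \<rho> (single y) $$ (i, m) * T $$ (m, l))"
    using mat_mult_entry[OF carr(1,3) i l] linear_to_mat_expand[OF lin(1) f i]
    by (simp add: sum_distrib_right)
  also have "\<dots> = (\<Sum>y\<in>H. f y * (\<Sum>m<d. \<rho> (single y) $$ (i, m) * T $$ (m, l)))"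
    by (subst sum.swap) (simp add: sum_distrib_left mult.assoc)
  also have "\<dots> = (\<Sum>y\<in>H. f y * (\<Sum>m<d'. T $$ (i, m) * \<sigma> (single y) $$ (m, l)))"
    by (simp add: move)
  also have "\<dots> = (\<Sum>y\<in>H. \<Sum>m<d'. T $$ (i, m) * (f y * \<sigma> (single y) $$ (m, l)))"
    by (simp add: sum_distrib_left mult.left_commute)
  also have "\<dots> = (\<Sum>m<d'. \<Sum>y\<in>H. T $$ (i, m) * (f y * \<sigma> (single y) $$ (m, l)))"
    by (rule sum.swap)
  also have "\<dots> = (T * \<sigma> f) $$ (i, l)"
    using mat_mult_entry[OF carr(3,2) i l] linear_to_mat_expand[OF lin(2) f _ l]
    by (simp add: sum_distrib_left)
  finally show "(\<rho> f * T) $$ (i, l) = (T * \<sigma> f) $$ (i, l)" .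
qed

lemma orthogonality_inequivalent:
  assumes \<rho>: "irreducible_rep H e \<rho>" and \<sigma>: "irreducible_rep H e \<sigma>"
    and ineq: "\<not> equivalent_reps H \<rho> \<sigma>"
    and "i < rep_dim \<rho>" "j < rep_dim \<rho>" "k < rep_dim \<sigma>" "l < rep_dim \<sigma>"
  shows "(\<Sum>x\<in>H. \<rho> (single (iv x)) $$ (i, j) * \<sigma> (single x) $$ (k, l)) = 0"
proof -
  define T where "T = mat (rep_dim \<rho>) (rep_dim \<sigma>)
    (\<lambda>(i, l). \<Sum>x\<in>H. \<rho> (single (iv x)) $$ (i, j) * \<sigma> (single x) $$ (k, l))"
  have "T = 0\<^sub>m (rep_dim \<rho>) (rep_dim \<sigma>)"
  proof (rule ccontr)
    assume "T \<noteq> 0\<^sub>m (rep_dim \<rho>) (rep_dim \<sigma>)"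
    then have "equivalent_reps H \<rho> \<sigma>"
      using averaged_intertwiner[OF irreducible_repD(1)[OF \<rho>] irreducible_repD(1)[OF \<sigma>] assms(5,6)]
      by (intro intertwiner_imp_equivalent[OF \<rho> \<sigma>, of T]) (auto simp: T_def)
    with ineq show False ..
  qed
  then have "T $$ (i, l) = 0" using assms by simp
  then show ?thesis using assms by (simp add: T_def)
qed

text \<open>
  By Schur's lemma the averaged matrix is a scalar matrix; the scalar is found from its trace.
\<close>

lemma orthogonality_same:
  assumes \<rho>: "irreducible_rep H e \<rho>"
    and i: "i < rep_dim \<rho>" and j: "j < rep_dim \<rho>" and k: "k < rep_dim \<rho>" and l: "l < rep_dim \<rho>"
  shows "(\<Sum>x\<in>H. \<rho> (single (iv x)) $$ (i, j) * \<rho> (single x) $$ (k, l))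
       = (if i = l \<and> j = k then of_nat (card H) / of_nat (rep_dim \<rho>) else 0)"
proof -
  let ?d = "rep_dim \<rho>"
  note rep = irreducible_repD(1)[OF \<rho>]
  define T where "T = mat ?d ?d
    (\<lambda>(i, l). \<Sum>x\<in>H. \<rho> (single (iv x)) $$ (i, j) * \<rho> (single x) $$ (k, l))"
  obtain c where c: "T = c \<cdot>\<^sub>m 1\<^sub>m ?d"
    using averaged_intertwiner[OF rep rep j k]
    by (rule_tac self_intertwiner_scalar[OF \<rho>, of T]) (auto simp: T_def)
  have "of_nat ?d * c = (\<Sum>i<?d. T $$ (i, i))"
    by (simp add: c)
  also have "\<dots> = (\<Sum>x\<in>H. \<Sum>i<?d. \<rho> (single x) $$ (k, i) * \<rho> (single (iv x)) $$ (i, j))"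
    by (subst sum.swap) (simp add: T_def mult.commute)
  also have "\<dots> = (\<Sum>x\<in>H. \<rho> (single (x * iv x)) $$ (k, j))"
    using j k by (intro sum.cong) (simp_all add: representation_mult_entry[OF rep] inv_closed)
  also have "\<dots> = of_nat (card H) * (if j = k then 1 else 0)"
    using j k by (simp add: inv_right representation_e_entry[OF rep])
  finally have "c = (if j = k then of_nat (card H) / of_nat ?d else 0)"
    using irreducible_repD(2)[OF \<rho>] by (auto simp: field_simps)
  moreover have "T $$ (i, l) = (if i = l then c else 0)"
    using i l by (simp add: c)
  ultimately show ?thesis
    using i l by (simp add: T_def)
qed

end

subsection \<open>The group algebra\<close>

lemma sum_fun_apply: "(\<Sum>a\<in>A. F a) x = (\<Sum>a\<in>A. F a x :: complex)"
  by (induction A rule: infinite_finite_induct) auto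

interpretation alg: vector_space "\<lambda>c (f :: 'a::finite alg) x. c * f x"
  by unfold_locales (auto simp: fun_eq_iff algebra_simps)

interpretation alg: finite_dimensional_vector_space
  "\<lambda>c (f :: 'a::finite alg) x. c * f x" "range single"
proof unfold_locales
  show "finite (range single :: 'a alg set)"
    by simp
  show "alg.independent (range single :: 'a alg set)"
    unfolding alg.independent_explicit_module
  proof (intro allI impI)
    fix T :: "'a alg set" and u v
    assume T: "finite T" "T \<subseteq> range single" and sum: "(\<Sum>v\<in>T. (\<lambda>x. u v * v x)) = 0" and v: "v \<in> T"
    obtain a where a: "v = single a" using T v by blast
    have wa: "w a = (if w = v then 1 else 0)" if "w \<in> T" for w
      using that T(2) unfolding a by (auto simp: single_def fun_eq_iff split: if_splits)
    have "(\<Sum>w\<in>T. u w * w a) = (\<Sum>w\<in>T. if w = v then u w else 0)"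
      by (intro sum.cong) (simp_all add: wa)
    moreover have "(\<Sum>w\<in>T. u w * w a) = 0"
      using fun_cong[OF sum, of a] by (simp add: sum_fun_apply)
    ultimately show "u v = 0"
      using T v by simp
  qed
  show "alg.span (range single) = (UNIV :: 'a alg set)"
  proof (intro equalityI subsetI)
    fix f :: "'a alg"
    have "(\<Sum>a\<in>UNIV. (\<lambda>x. f a * single a x)) \<in> alg.span (range single)"
      by (intro alg.span_sum alg.span_scale alg.span_base) auto
    also have "(\<Sum>a\<in>UNIV. (\<lambda>x. f a * single a x)) = f"
      by (simp add: fun_eq_iff sum_fun_apply single_def if_distrib cong: if_cong)
    finally show "f \<in> alg.span (range single)" .
  qed simp
qed

lemma conv_eq: "conv f g x = (\<Sum>p | fst p * snd p = x. f (fst p) * g (snd p))"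
  unfolding conv_def split_def ..

lemma conv_add_left: "conv (\<lambda>x. f x + g x) h = (\<lambda>x. conv f h x + conv g h x)"
  by (rule ext) (simp only: conv_eq distrib_right sum.distrib)

lemma conv_scale_left: "conv (\<lambda>x. c * f x) h = (\<lambda>x. c * conv f h x)"
  by (rule ext) (simp only: conv_eq sum_distrib_left mult.assoc)

lemma conv_sum_right:
  "conv f (\<lambda>x. \<Sum>i\<in>T. c i * g i x) = (\<lambda>x. \<Sum>i\<in>T. c i * conv f (g i) x)"
proof
  fix x
  have "conv f (\<lambda>x. \<Sum>i\<in>T. c i * g i x) x
      = (\<Sum>p | fst p * snd p = x. \<Sum>i\<in>T. c i * (f (fst p) * g i (snd p)))"
    by (simp only: conv_eq sum_distrib_left mult.left_commute)
  also have "\<dots> = (\<Sum>i\<in>T. \<Sum>p | fst p * snd p = x. c i * (f (fst p) * g i (snd p)))"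
    by (rule sum.swap)
  also have "\<dots> = (\<Sum>i\<in>T. c i * conv f (g i) x)"
    by (simp only: conv_eq sum_distrib_left)
  finally show "conv f (\<lambda>x. \<Sum>i\<in>T. c i * g i x) x = (\<Sum>i\<in>T. c i * conv f (g i) x)" .
qed

lemma sum_mult_cnj_eq_0:
  assumes "finite A" "(\<Sum>x\<in>A. f x * cnj (f x)) = 0" "x \<in> A"
  shows "f x = 0"
proof -
  have "complex_of_real (\<Sum>x\<in>A. (cmod (f x))\<^sup>2) = 0"
    using assms(2) by (simp only: complex_norm_square of_real_sum)
  then have "(\<Sum>x\<in>A. (cmod (f x))\<^sup>2) = 0"
    by (simp only: of_real_eq_0_iff)
  then show ?thesis
    using assms by (simp add: sum_nonneg_eq_0_iff)
qed

context finite_group_in_semigroup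
begin

lemma conv_closed:
  assumes f: "f \<in> alg_on H" and g: "g \<in> alg_on H"
  shows "conv f g \<in> alg_on H"
  unfolding alg_on_def
proof (intro CollectI allI impI)
  fix x
  assume "x \<notin> H"
  then have "f (fst p) * g (snd p) = 0" if "fst p * snd p = x" for p
    using that mult_closed f g by (auto simp: alg_on_def)
  then show "conv f g x = 0"
    unfolding conv_eq by (intro sum.neutral) auto
qed

text \<open>
  In a group, the pairs with product \<open>x\<close> are parametrized by their first component.
\<close>

lemma conv_apply:
  assumes f: "f \<in> alg_on H" and g: "g \<in> alg_on H" and x: "x \<in> H"
  shows "conv f g x = (\<Sum>a\<in>H. f a * g (iv a * x))"
proof -
  have "conv f g x = (\<Sum>p\<in>{p \<in> H \<times> H. fst p * snd p = x}. f (fst p) * g (snd p))"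
    unfolding conv_eq
    by (rule sum.mono_neutral_right) (use f g in \<open>auto simp: alg_on_def\<close>)
  also have "\<dots> = (\<Sum>a\<in>H. f a * g (iv a * x))"
    by (rule sum.reindex_bij_witness[of _ "\<lambda>a. (a, iv a * x)" fst])
       (use x in \<open>auto simp: mult_closed inv_closed inv_mult_cancel mult_inv_cancel\<close>)
  finally show ?thesis .
qed

lemma conv_e_left:
  assumes "u \<in> alg_on H"
  shows "conv (single e) u = u"
proof
  fix x
  show "conv (single e) u x = u x"
  proof (cases "x \<in> H")
    case True
    have "conv (single e) u x = (\<Sum>a\<in>H. if a = e then u (iv a * x) else 0)"
      unfolding conv_apply[OF alg_on_single[OF e_closed] assms True]
      by (intro sum.cong) (auto simp: single_def)
    then show ?thesis
      by (simp add: e_closed inv_e e_left True)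
  next
    case False
    then show ?thesis
      using assms conv_closed[OF alg_on_single[OF e_closed] assms] by (simp add: alg_on_def)
  qed
qed

lemma conv_assoc:
  assumes f: "f \<in> alg_on H" and g: "g \<in> alg_on H" and h: "h \<in> alg_on H"
  shows "conv (conv f g) h = conv f (conv g h)"
proof
  fix x
  show "conv (conv f g) h x = conv f (conv g h) x"
  proof (cases "x \<in> H")
    case x: True
    have "conv (conv f g) h x = (\<Sum>u\<in>H. \<Sum>a\<in>H. f a * (g (iv a * u) * h (iv u * x)))"
      unfolding conv_apply[OF conv_closed[OF f g] h x]
      by (intro sum.cong) (simp_all add: conv_apply[OF f g] sum_distrib_right mult.assoc)
    also have "\<dots> = (\<Sum>a\<in>H. \<Sum>u\<in>H. f a * (g (iv a * u) * h (iv u * x)))"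
      by (rule sum.swap)
    also have "\<dots> = (\<Sum>a\<in>H. \<Sum>u\<in>H. f a * (g (iv a * (a * u)) * h (iv (a * u) * x)))"
      by (intro sum.cong sum_translate_left[symmetric]) auto
    also have "\<dots> = (\<Sum>a\<in>H. \<Sum>u\<in>H. f a * (g u * h (iv u * (iv a * x))))"
      by (intro sum.cong) (simp_all add: inv_mult_cancel inv_mult mult.assoc)
    also have "\<dots> = conv f (conv g h) x"
      unfolding conv_apply[OF f conv_closed[OF g h] x]
      by (intro sum.cong) (simp_all add: conv_apply[OF g h] mult_closed inv_closed x sum_distrib_left)
    finally show ?thesis .
  next
    case False
    then show ?thesis
      using conv_closed[OF conv_closed[OF f g] h] conv_closed[OF f conv_closed[OF g h]]
      by (simp add: alg_on_def)
  qed
qed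

text \<open>
  As \<open>w\<close> is self-adjoint, the value of \<open>conv w w\<close> at the identity is the sum of the squared absolute values of \<open>w\<close>.
\<close>

lemma self_adjoint_square_eq_0:
  assumes w: "w \<in> alg_on H" and adj: "\<And>x. x \<in> H \<Longrightarrow> w (iv x) = cnj (w x)"
    and sq: "conv w w = (\<lambda>_. 0)"
  shows "w = (\<lambda>_. 0)"
proof -
  have "(\<Sum>a\<in>H. w a * cnj (w a)) = conv w w e"
    unfolding conv_apply[OF w w e_closed]
    by (intro sum.cong) (simp_all add: e_right inv_closed adj)
  then have "(\<Sum>a\<in>H. w a * cnj (w a)) = 0"
    by (simp add: sq)
  then have "w x = 0" if "x \<in> H" for x
    using that by (intro sum_mult_cnj_eq_0[of H w x]) auto
  then show ?thesis
    using w by (auto simp: alg_on_def)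
qed

text \<open>
  The conjugate-linear involution of the group algebra that inverts group elements.
\<close>

definition star :: "'a alg \<Rightarrow> 'a alg" where
  "star u = (\<lambda>x. if x \<in> H then cnj (u (iv x)) else 0)"

lemma star_closed: "star u \<in> alg_on H"
  by (simp add: star_def alg_on_def)

lemma star_conv_self:
  assumes u: "u \<in> alg_on H" and x: "x \<in> H"
  shows "conv (star u) u x = (\<Sum>c\<in>H. cnj (u c) * u (c * x))"
  unfolding conv_apply[OF star_closed u x]
  by (rule sum.reindex_bij_witness[of _ iv iv]) (auto simp: star_def inv_closed inv_inv)

lemma star_conv_self_adjoint:
  assumes u: "u \<in> alg_on H" and x: "x \<in> H"
  shows "conv (star u) u (iv x) = cnj (conv (star u) u x)"
proof -
  have "conv (star u) u (iv x) = (\<Sum>c\<in>H. cnj (u c) * u (c * iv x))"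
    by (simp add: star_conv_self u x inv_closed)
  also have "\<dots> = (\<Sum>c\<in>H. cnj (u (c * x)) * u (c * x * iv x))"
    by (rule sum_translate_right[OF x, symmetric])
  also have "\<dots> = cnj (conv (star u) u x)"
    by (simp add: star_conv_self u x mult_right_cancel_inv mult.commute)
  finally show ?thesis .
qed

lemma star_conv_self_eq_0:
  assumes u: "u \<in> alg_on H" and "conv (star u) u = (\<lambda>_. 0)"
  shows "u = (\<lambda>_. 0)"
proof -
  have "(\<Sum>c\<in>H. u c * cnj (u c)) = conv (star u) u e"
    by (simp add: star_conv_self u e_closed e_right mult.commute)
  then have "(\<Sum>c\<in>H. u c * cnj (u c)) = 0"
    by (simp add: assms(2))
  then have "u x = 0" if "x \<in> H" for x
    using that by (intro sum_mult_cnj_eq_0[of H u x]) auto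
  then show ?thesis
    using u by (auto simp: alg_on_def)
qed

definition left_ideal :: "'a alg set \<Rightarrow> bool" where
  "left_ideal U \<longleftrightarrow> alg.subspace U \<and> U \<subseteq> alg_on H \<and> (\<forall>f\<in>alg_on H. \<forall>u\<in>U. conv f u \<in> U)"

text \<open>
  Left multiplication on \<open>U\<close>, written in a basis \<open>b\<close> of \<open>U\<close>, is the representation \<open>R\<close>. The map
  \<open>\<phi>\<close> that sends a coordinate vector to the corresponding element of \<open>U\<close> is bijective and
  intertwines \<open>R\<close> with left multiplication, so the axioms for \<open>R\<close> can be checked in \<open>U\<close>, and it
  turns invariant subspaces for \<open>R\<close> into left ideals inside \<open>U\<close>, which minimality restricts.
\<close>

lemma minimal_left_ideal_affords_irreducible:
  assumes U: "left_ideal U" "U \<noteq> {0}"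
    and min: "\<And>V. left_ideal V \<Longrightarrow> V \<subseteq> U \<Longrightarrow> V \<noteq> {0} \<Longrightarrow> V = U"
  obtains R where "irreducible_rep H e R"
    "\<And>f u. f \<in> alg_on H \<Longrightarrow> R f = 0\<^sub>m (rep_dim R) (rep_dim R) \<Longrightarrow> u \<in> U \<Longrightarrow> conv f u = 0"
proof -
  have sub: "alg.subspace U" and UH: "U \<subseteq> alg_on H"
    and inv: "\<And>f u. f \<in> alg_on H \<Longrightarrow> u \<in> U \<Longrightarrow> conv f u \<in> U"
    using U by (auto simp: left_ideal_def)
  obtain B where B: "B \<subseteq> U" "alg.independent B" "U \<subseteq> alg.span B"
    by (rule alg.basis_exists[of U])
  have finB: "finite B"
    using B(2) by (rule alg.finiteI_independent)
  define d where "d = card B"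
  obtain b where b: "bij_betw b {..<d} B"
    using ex_bij_betw_nat_finite[OF finB] by (auto simp: d_def lessThan_atLeast0)
  have bU: "b i \<in> U" if "i < d" for i
    using that b B(1) by (auto simp: bij_betw_def)
  define \<phi> where "\<phi> w = (\<lambda>x. \<Sum>i<d. w $ i * b i x)" for w :: "complex vec"
  define coord where "coord u i = alg.representation B u (b i)" for u i
  have U_coord: "(\<lambda>x. \<Sum>i<d. coord u i * b i x) = u" if "u \<in> U" for u
  proof -
    have "(\<Sum>v\<in>B. (\<lambda>x. alg.representation B u v * v x)) = u"
      using that B finB by (intro alg.sum_representation_eq) auto
    moreover have "(\<Sum>v\<in>B. (\<lambda>x. alg.representation B u v * v x))
        = (\<Sum>i<d. (\<lambda>x. coord u i * b i x))"
      unfolding coord_def by (rule sum.reindex_bij_betw[OF b, symmetric])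
    ultimately show ?thesis
      by (simp add: fun_eq_iff sum_fun_apply)
  qed
  have \<phi>_U: "\<phi> w \<in> U" for w
  proof -
    have "(\<Sum>i<d. (\<lambda>x. w $ i * b i x)) \<in> U"
      using sub bU by (intro alg.subspace_sum alg.subspace_scale) auto
    also have "(\<Sum>i<d. (\<lambda>x. w $ i * b i x)) = \<phi> w"
      by (simp add: \<phi>_def fun_eq_iff sum_fun_apply)
    finally show ?thesis .
  qed
  have \<phi>_surj: "\<phi> (vec d (coord u)) = u" if "u \<in> U" for u
    using U_coord[OF that] by (simp add: \<phi>_def)
  have \<phi>_add: "\<phi> (v + w) = \<phi> v + \<phi> w" if "v \<in> carrier_vec d" "w \<in> carrier_vec d" for v w
    using that by (simp add: \<phi>_def fun_eq_iff distrib_right sum.distrib)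
  have \<phi>_scale: "\<phi> (c \<cdot>\<^sub>v v) = (\<lambda>x. c * \<phi> v x)" if "v \<in> carrier_vec d" for c v
    using that by (simp add: \<phi>_def fun_eq_iff sum_distrib_left mult.assoc)
  have \<phi>_zero: "\<phi> (0\<^sub>v d) = 0"
    by (simp add: \<phi>_def fun_eq_iff)
  have \<phi>_eq_0: "w = 0\<^sub>v d" if w: "w \<in> carrier_vec d" and "\<phi> w = 0" for w
  proof (rule eq_vecI)
    fix i
    assume "i < dim_vec (0\<^sub>v d :: complex vec)"
    then have i: "i < d" by simp
    \<comment> \<open>the coordinates of \<open>w\<close> as coefficients indexed by the basis elements\<close>
    define c where "c v = w $ (the_inv_into {..<d} b v)" for v
    have cb: "c (b j) = w $ j" if "j < d" for j
      using that b by (simp add: c_def bij_betw_def the_inv_into_f_f)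
    have "(\<Sum>v\<in>B. (\<lambda>x. c v * v x)) = (\<Sum>j<d. (\<lambda>x. c (b j) * b j x))"
      by (rule sum.reindex_bij_betw[OF b, symmetric])
    also have "\<dots> = \<phi> w"
      by (simp add: \<phi>_def fun_eq_iff sum_fun_apply cb)
    finally have "(\<Sum>v\<in>B. (\<lambda>x. c v * v x)) = 0"
      using \<open>\<phi> w = 0\<close> by simp
    then have "c (b i) = 0"
      using B(2) finB b i unfolding alg.independent_explicit_module bij_betw_def by blast
    then show "w $ i = 0\<^sub>v d $ i"
      using i by (simp add: cb)
  qed (use w in simp)
  have \<phi>_inj: "v = w" if "v \<in> carrier_vec d" "w \<in> carrier_vec d" "\<phi> v = \<phi> w" for v w
  proof -
    have "\<phi> (v + (-1) \<cdot>\<^sub>v w) = 0"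
      using that by (subst \<phi>_add) (auto simp: \<phi>_scale fun_eq_iff)
    then have z: "v + (-1) \<cdot>\<^sub>v w = 0\<^sub>v d"
      using that by (intro \<phi>_eq_0) auto
    show ?thesis
    proof (rule eq_vecI)
      fix i
      assume "i < dim_vec w"
      then have "(v + (-1) \<cdot>\<^sub>v w) $ i = v $ i - w $ i" "i < d"
        using that by auto
      then show "v $ i = w $ i" by (simp add: z)
    qed (use that in auto)
  qed
  define R where "R f = mat d d (\<lambda>(i, j). coord (conv f (b j)) i)" for f
  have R_carr: "R f \<in> carrier_mat d d" for f
    by (simp add: R_def)
  have dim: "rep_dim R = d"
    by (simp add: rep_dim_def R_def)
  have R_act: "\<phi> (R f *\<^sub>v w) = conv f (\<phi> w)" if f: "f \<in> alg_on H" and w: "w \<in> carrier_vec d" for f w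
  proof
    fix x
    have "conv f (\<phi> w) x = (\<Sum>j<d. w $ j * conv f (b j) x)"
      unfolding \<phi>_def conv_sum_right ..
    also have "\<dots> = (\<Sum>j<d. w $ j * (\<Sum>i<d. coord (conv f (b j)) i * b i x))"
      using fun_cong[OF U_coord[OF inv[OF f bU]], of _ x] by (intro sum.cong) simp_all
    also have "\<dots> = (\<Sum>i<d. \<Sum>j<d. w $ j * (coord (conv f (b j)) i * b i x))"
      by (simp add: sum_distrib_left) (rule sum.swap)
    also have "\<dots> = \<phi> (R f *\<^sub>v w) x"
      using w unfolding \<phi>_def
      by (intro sum.cong) (auto simp: R_def scalar_prod_def lessThan_atLeast0 sum_distrib_left sum_distrib_right mult_ac)
    finally show "\<phi> (R f *\<^sub>v w) x = conv f (\<phi> w) x" ..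
  qed
  have R_eqI: "R f = M" if "f \<in> alg_on H" "M \<in> carrier_mat d d"
    "\<And>w. w \<in> carrier_vec d \<Longrightarrow> conv f (\<phi> w) = \<phi> (M *\<^sub>v w)" for f M
  proof (rule mat_eq_iff_mult_vec[OF R_carr that(2)])
    fix w :: "complex vec"
    assume w: "w \<in> carrier_vec d"
    show "R f *\<^sub>v w = M *\<^sub>v w"
      by (rule \<phi>_inj) (use that w R_carr[of f] R_act[OF that(1) w] in auto)
  qed
  have R_act': "R f *\<^sub>v w \<in> carrier_vec d" if "w \<in> carrier_vec d" for f w
    using that R_carr[of f] by simp
  have "linear_to_mat (alg_on H) d R"
    unfolding linear_to_mat_def
  proof (intro conjI ballI allI R_carr)
    fix f g
    assume f: "f \<in> alg_on H" and g: "g \<in> alg_on H"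
    show "R (\<lambda>x. f x + g x) = R f + R g"
    proof (rule R_eqI)
      fix w :: "complex vec"
      assume w: "w \<in> carrier_vec d"
      have "(R f + R g) *\<^sub>v w = R f *\<^sub>v w + R g *\<^sub>v w"
        by (rule add_mult_distrib_mat_vec[OF R_carr R_carr w])
      then show "conv (\<lambda>x. f x + g x) (\<phi> w) = \<phi> ((R f + R g) *\<^sub>v w)"
        by (simp add: conv_add_left \<phi>_add R_act R_act' f g w fun_eq_iff)
    qed (use f g R_carr in \<open>auto intro: alg_on_add\<close>)
  next
    fix c f
    assume f: "f \<in> alg_on H"
    show "R (\<lambda>x. c * f x) = c \<cdot>\<^sub>m R f"
    proof (rule R_eqI)
      fix w :: "complex vec"
      assume w: "w \<in> carrier_vec d"
      have "(c \<cdot>\<^sub>m R f) *\<^sub>v w = c \<cdot>\<^sub>v (R f *\<^sub>v w)"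
        using w R_carr[of f] by (intro eq_vecI) auto
      then show "conv (\<lambda>x. c * f x) (\<phi> w) = \<phi> ((c \<cdot>\<^sub>m R f) *\<^sub>v w)"
        by (simp add: conv_scale_left \<phi>_scale R_act R_act' f w)
    qed (use f R_carr in \<open>auto intro: alg_on_scale\<close>)
  qed
  moreover have "R (conv f g) = R f * R g" if f: "f \<in> alg_on H" and g: "g \<in> alg_on H" for f g
  proof (rule R_eqI)
    fix w :: "complex vec"
    assume w: "w \<in> carrier_vec d"
    have "(R f * R g) *\<^sub>v w = R f *\<^sub>v (R g *\<^sub>v w)"
      by (rule assoc_mult_mat_vec[OF R_carr R_carr w])
    moreover have "\<phi> w \<in> alg_on H"
      using \<phi>_U UH by blast
    ultimately show "conv (conv f g) (\<phi> w) = \<phi> ((R f * R g) *\<^sub>v w)"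
      by (simp add: conv_assoc R_act R_act' f g w)
  qed (use f g R_carr in \<open>auto intro: conv_closed mult_carrier_mat\<close>)
  moreover have "R (single e) = 1\<^sub>m d"
  proof (rule R_eqI)
    fix w :: "complex vec"
    assume w: "w \<in> carrier_vec d"
    have "\<phi> w \<in> alg_on H"
      using \<phi>_U UH by blast
    then show "conv (single e) (\<phi> w) = \<phi> (1\<^sub>m d *\<^sub>v w)"
      using w by (simp add: conv_e_left)
  qed (use alg_on_single[OF e_closed] in auto)
  ultimately have rep: "representation H e d R"
    by (simp add: representation_def)
  have "d > 0"
  proof (rule ccontr)
    assume "\<not> d > 0"
    then have "B = {}" using finB by (simp add: d_def)
    then have "U \<subseteq> {0}" using B(3) by simp
    moreover have "0 \<in> U" using sub by (rule alg.subspace_0)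
    ultimately show False using U(2) by blast
  qed
  have irr: "irreducible_rep H e R"
    unfolding irreducible_rep_def dim subspace_module_vec_iff
  proof (intro conjI allI impI rep \<open>d > 0\<close>)
    fix W
    assume W: "(W \<subseteq> carrier_vec d \<and> 0\<^sub>v d \<in> W \<and> (\<forall>v\<in>W. \<forall>w\<in>W. v + w \<in> W) \<and> (\<forall>c. \<forall>v\<in>W. c \<cdot>\<^sub>v v \<in> W)) \<and>
      (\<forall>f\<in>alg_on H. \<forall>w\<in>W. R f *\<^sub>v w \<in> W)"
    have Wc: "w \<in> carrier_vec d" if "w \<in> W" for w
      using W that by blast
    have "left_ideal (\<phi> ` W)"
      unfolding left_ideal_def
    proof (intro conjI ballI)
      show "alg.subspace (\<phi> ` W)"
      proof (rule alg.subspaceI)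
        show "0 \<in> \<phi> ` W"
          using W \<phi>_zero by (metis image_eqI)
        fix u v
        assume "u \<in> \<phi> ` W" "v \<in> \<phi> ` W"
        then obtain v' w' where *: "v' \<in> W" "w' \<in> W" "u = \<phi> v'" "v = \<phi> w'"
          by auto
        then have "u + v = \<phi> (v' + w')"
          by (simp add: \<phi>_add Wc)
        moreover have "v' + w' \<in> W"
          using W * by simp
        ultimately show "u + v \<in> \<phi> ` W"
          by (rule image_eqI)
      next
        fix c u
        assume "u \<in> \<phi> ` W"
        then obtain w where *: "w \<in> W" "u = \<phi> w"
          by auto
        then have "(\<lambda>x. c * u x) = \<phi> (c \<cdot>\<^sub>v w)"
          by (simp add: \<phi>_scale Wc)
        moreover have "c \<cdot>\<^sub>v w \<in> W"
          using W * by simp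
        ultimately show "(\<lambda>x. c * u x) \<in> \<phi> ` W"
          by (rule image_eqI)
      qed
      show "\<phi> ` W \<subseteq> alg_on H"
        using \<phi>_U UH by blast
      fix f u
      assume f: "f \<in> alg_on H" and "u \<in> \<phi> ` W"
      then obtain w where w: "w \<in> W" "u = \<phi> w" by blast
      then have "conv f u = \<phi> (R f *\<^sub>v w)" "R f *\<^sub>v w \<in> W"
        using R_act[OF f Wc] W f by auto
      then show "conv f u \<in> \<phi> ` W" by blast
    qed
    moreover have "\<phi> ` W \<subseteq> U"
      using \<phi>_U by blast
    ultimately consider "\<phi> ` W = {0}" | "\<phi> ` W = U"
      using min by blast
    then show "W = {0\<^sub>v d} \<or> W = carrier_vec d"
    proof cases
      case 1
      then have "w = 0\<^sub>v d" if "w \<in> W" for w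
        using \<phi>_eq_0 Wc that by blast
      with W show ?thesis by blast
    next
      case 2
      have "w \<in> W" if w: "w \<in> carrier_vec d" for w
      proof -
        obtain w' where "w' \<in> W" "\<phi> w' = \<phi> w"
          using \<phi>_U[of w] 2 by (metis imageE)
        then show ?thesis
          using \<phi>_inj[OF Wc w] by blast
      qed
      with W show ?thesis by blast
    qed
  qed
  show thesis
  proof (rule that[OF irr])
    fix f u
    assume f: "f \<in> alg_on H" and R0: "R f = 0\<^sub>m (rep_dim R) (rep_dim R)" and u: "u \<in> U"
    let ?w = "vec d (coord u)"
    have "conv f u = \<phi> (R f *\<^sub>v ?w)"
      using R_act[OF f, of ?w] \<phi>_surj[OF u] by simp
    also have "R f *\<^sub>v ?w = 0\<^sub>v d"
      unfolding R0 dim by (intro eq_vecI) auto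
    finally show "conv f u = 0"
      by (simp only: \<phi>_zero)
  qed
qed

end

subsection \<open>Column orthogonality\<close>

context finite_group_in_semigroup
begin

text \<open>
  Semisimplicity of the group algebra, in the form that its radical vanishes. A minimal left ideal
  inside the radical would annihilate itself, which positivity of \<open>conv (star u) u\<close> excludes.
\<close>

lemma annihilated_by_irreducibles_eq_0:
  assumes compl: "complete_irreps H e I"
    and f: "f \<in> alg_on H" and kill: "\<And>\<sigma>. \<sigma> \<in> I \<Longrightarrow> \<sigma> f = 0\<^sub>m (rep_dim \<sigma>) (rep_dim \<sigma>)"
  shows "f = (\<lambda>_. 0)"
proof (rule ccontr)
  assume "f \<noteq> (\<lambda>_. 0)"
  \<comment> \<open>the common kernel of the representations in \<open>I\<close>\<close>
  define J where "J = {f \<in> alg_on H. \<forall>\<sigma>\<in>I. \<sigma> f = 0\<^sub>m (rep_dim \<sigma>) (rep_dim \<sigma>)}"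
  have irr: "irreducible_rep H e \<sigma>" if "\<sigma> \<in> I" for \<sigma>
    using compl that by (simp add: complete_irreps_def)
  have rep_zero: "\<sigma> (\<lambda>_. 0) = 0\<^sub>m (rep_dim \<sigma>) (rep_dim \<sigma>)" if "\<sigma> \<in> I" for \<sigma>
  proof -
    note lin = irreducible_repD(4)[OF irr[OF that]]
    have "\<sigma> (\<lambda>_. 0) = 0 \<cdot>\<^sub>m \<sigma> (\<lambda>_. 0)"
      using linear_to_matD(3)[OF lin alg_on_zero, of 0] by simp
    also have "\<dots> = 0\<^sub>m (rep_dim \<sigma>) (rep_dim \<sigma>)"
      using linear_to_matD(1)[OF lin alg_on_zero] by (intro eq_matI) auto
    finally show ?thesis .
  qed
  have J: "left_ideal J"
    unfolding left_ideal_def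
  proof (intro conjI ballI)
    show "alg.subspace J"
    proof (rule alg.subspaceI)
      show "0 \<in> J"
        using rep_zero alg_on_zero by (simp add: J_def zero_fun_def)
    next
      fix u v
      assume "u \<in> J" "v \<in> J"
      then have u: "u \<in> alg_on H" "\<And>\<sigma>. \<sigma> \<in> I \<Longrightarrow> \<sigma> u = 0\<^sub>m (rep_dim \<sigma>) (rep_dim \<sigma>)"
        and v: "v \<in> alg_on H" "\<And>\<sigma>. \<sigma> \<in> I \<Longrightarrow> \<sigma> v = 0\<^sub>m (rep_dim \<sigma>) (rep_dim \<sigma>)"
        by (auto simp: J_def)
      have "\<sigma> (\<lambda>x. u x + v x) = 0\<^sub>m (rep_dim \<sigma>) (rep_dim \<sigma>)" if "\<sigma> \<in> I" for \<sigma>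
        using linear_to_matD(2)[OF irreducible_repD(4)[OF irr[OF that]] u(1) v(1)] u(2)[OF that] v(2)[OF that]
        by simp
      then show "u + v \<in> J"
        using alg_on_add[OF u(1) v(1)] by (simp add: J_def plus_fun_def)
    next
      fix c u
      assume "u \<in> J"
      then have u: "u \<in> alg_on H" "\<And>\<sigma>. \<sigma> \<in> I \<Longrightarrow> \<sigma> u = 0\<^sub>m (rep_dim \<sigma>) (rep_dim \<sigma>)"
        by (auto simp: J_def)
      have "\<sigma> (\<lambda>x. c * u x) = 0\<^sub>m (rep_dim \<sigma>) (rep_dim \<sigma>)" if "\<sigma> \<in> I" for \<sigma>
      proof -
        have "\<sigma> (\<lambda>x. c * u x) = c \<cdot>\<^sub>m 0\<^sub>m (rep_dim \<sigma>) (rep_dim \<sigma>)"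
          using linear_to_matD(3)[OF irreducible_repD(4)[OF irr[OF that]] u(1), of c] u(2)[OF that]
          by simp
        also have "\<dots> = 0\<^sub>m (rep_dim \<sigma>) (rep_dim \<sigma>)"
          by (intro eq_matI) auto
        finally show ?thesis .
      qed
      then show "(\<lambda>x. c * u x) \<in> J"
        using alg_on_scale[OF u(1)] by (simp add: J_def)
    qed
    show "J \<subseteq> alg_on H"
      by (auto simp: J_def)
    fix g u
    assume g: "g \<in> alg_on H" and "u \<in> J"
    then have u: "u \<in> alg_on H" "\<And>\<sigma>. \<sigma> \<in> I \<Longrightarrow> \<sigma> u = 0\<^sub>m (rep_dim \<sigma>) (rep_dim \<sigma>)"
      by (auto simp: J_def)
    have "\<sigma> (conv g u) = 0\<^sub>m (rep_dim \<sigma>) (rep_dim \<sigma>)" if "\<sigma> \<in> I" for \<sigma>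
    proof -
      have "\<sigma> (conv g u) = \<sigma> g * \<sigma> u"
        using irreducible_repD(1)[OF irr[OF that]] g u(1) by (simp add: representation_def)
      then show ?thesis
        using irreducible_repD(3)[OF irr[OF that] g] u(2)[OF that] by simp
    qed
    then show "conv g u \<in> J"
      using conv_closed[OF g u(1)] by (simp add: J_def)
  qed
  have "f \<in> J"
    using f kill by (simp add: J_def)
  then have J0: "J \<noteq> {0}"
    using \<open>f \<noteq> (\<lambda>_. 0)\<close> by (auto simp: zero_fun_def)
  let ?P = "\<lambda>U. left_ideal U \<and> U \<subseteq> J \<and> U \<noteq> {0}"
  obtain U where U: "?P U" and least: "\<And>V. ?P V \<Longrightarrow> alg.dim U \<le> alg.dim V"
    using ex_has_least_nat[of ?P J alg.dim] J J0 by auto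
  have min: "V = U" if V: "left_ideal V" "V \<subseteq> U" "V \<noteq> {0}" for V
  proof (rule alg.subspace_dim_equal)
    show "alg.subspace V" "alg.subspace U"
      using U V by (simp_all add: left_ideal_def)
    show "V \<subseteq> U" by fact
    show "alg.dim U \<le> alg.dim V"
      using U V by (intro least) auto
  qed
  obtain R where R: "irreducible_rep H e R"
    and faithful: "\<And>f u. f \<in> alg_on H \<Longrightarrow> R f = 0\<^sub>m (rep_dim R) (rep_dim R) \<Longrightarrow> u \<in> U \<Longrightarrow> conv f u = 0"
    by (rule minimal_left_ideal_affords_irreducible[of U]) (use U min in auto)
  obtain \<sigma> where \<sigma>: "\<sigma> \<in> I" "equivalent_reps H R \<sigma>"
    using compl R by (auto simp: complete_irreps_def)
  then obtain P Q where PQ: "\<And>f. f \<in> alg_on H \<Longrightarrow> similar_mat_wit (R f) (\<sigma> f) P Q"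
    by (auto simp: equivalent_reps_def)
  have UJ: "u \<in> alg_on H \<and> \<sigma> u = 0\<^sub>m (rep_dim \<sigma>) (rep_dim \<sigma>)" if "u \<in> U" for u
    using U that \<sigma>(1) by (auto simp: J_def)
  have square_zero: "conv v u = 0" if "v \<in> U" "u \<in> U" for u v
  proof (rule faithful)
    show v: "v \<in> alg_on H" using UJ that(1) by blast
    have \<sigma>0: "\<sigma> v = 0\<^sub>m (rep_dim \<sigma>) (rep_dim \<sigma>)" using UJ that(1) by blast
    note sim = similar_mat_witD[OF refl PQ[OF v]]
    have row: "dim_row (R v) = rep_dim R"
      using irreducible_repD(3)[OF R v] by simp
    have "rep_dim \<sigma> = rep_dim R"
      using carrier_matD(1)[OF sim(5)] \<sigma>0 row by simp
    then have "P * \<sigma> v * Q = 0\<^sub>m (rep_dim R) (rep_dim R)"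
      using sim(6,7) unfolding \<sigma>0 row by simp
    then show "R v = 0\<^sub>m (rep_dim R) (rep_dim R)"
      using sim(3) by simp
  qed (rule that(2))
  have "0 \<in> U"
    by (rule alg.subspace_0) (use U in \<open>simp add: left_ideal_def\<close>)
  then obtain u where u: "u \<in> U" "u \<noteq> 0"
    using U by blast
  have uH: "u \<in> alg_on H" using UJ u(1) by blast
  have "conv (star u) u \<in> U"
    using U star_closed u(1) by (simp add: left_ideal_def)
  then have square: "conv (conv (star u) u) (conv (star u) u) = (\<lambda>_. 0)"
    using square_zero by (simp add: zero_fun_def)
  have "conv (star u) u = (\<lambda>_. 0)"
  proof (rule self_adjoint_square_eq_0)
    show "conv (star u) u \<in> alg_on H"
      by (rule conv_closed[OF star_closed uH])
    show "conv (star u) u (iv x) = cnj (conv (star u) u x)" if "x \<in> H" for x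
      by (rule star_conv_self_adjoint[OF uH that])
  qed (rule square)
  then have "u = (\<lambda>_. 0)"
    by (rule star_conv_self_eq_0[OF uH])
  with u(2) show False
    by (simp add: zero_fun_def)
qed

definition character :: "('a alg \<Rightarrow> complex mat) \<Rightarrow> 'a \<Rightarrow> complex" where
  "character \<rho> x = (\<Sum>i<rep_dim \<rho>. \<rho> (single x) $$ (i, i))"

lemma character_mult:
  assumes "representation H e (rep_dim \<rho>) \<rho>" "x \<in> H" "y \<in> H"
  shows "character \<rho> (x * y)
    = (\<Sum>i<rep_dim \<rho>. \<Sum>m<rep_dim \<rho>. \<rho> (single x) $$ (i, m) * \<rho> (single y) $$ (m, i))"
  unfolding character_def by (intro sum.cong) (simp_all add: representation_mult_entry[OF assms])

text \<open>
  Up to the factor \<open>rep_dim \<sigma> / card H\<close>, the average is the projection onto the part of \<open>\<sigma>\<close>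
  equivalent to \<open>\<rho>\<close>: the identity for \<open>\<rho> = \<sigma>\<close> and zero otherwise. The formula is the sum of the
  orthogonality relations over the diagonal entries of \<open>\<rho>\<close>.
\<close>

lemma character_averages_to_projection:
  assumes compl: "complete_irreps H e I" and \<rho>: "\<rho> \<in> I" and \<sigma>: "\<sigma> \<in> I"
    and k: "k < rep_dim \<sigma>" and l: "l < rep_dim \<sigma>"
  shows "(\<Sum>x\<in>H. character \<rho> (iv x) * \<sigma> (single x) $$ (k, l))
       = (if \<rho> = \<sigma> \<and> k = l then of_nat (card H) / of_nat (rep_dim \<sigma>) else 0)"
proof -
  have irr: "irreducible_rep H e \<rho>" "irreducible_rep H e \<sigma>"
    and ineq: "\<rho> \<noteq> \<sigma> \<Longrightarrow> \<not> equivalent_reps H \<rho> \<sigma>"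
    using compl \<rho> \<sigma> by (auto simp: complete_irreps_def)
  have "(\<Sum>x\<in>H. character \<rho> (iv x) * \<sigma> (single x) $$ (k, l))
      = (\<Sum>i<rep_dim \<rho>. \<Sum>x\<in>H. \<rho> (single (iv x)) $$ (i, i) * \<sigma> (single x) $$ (k, l))"
    by (simp add: character_def sum_distrib_right) (rule sum.swap)
  also have "\<dots> = (if \<rho> = \<sigma> \<and> k = l then of_nat (card H) / of_nat (rep_dim \<sigma>) else 0)"
  proof (cases "\<rho> = \<sigma>")
    case True
    have "(\<Sum>i<rep_dim \<rho>. \<Sum>x\<in>H. \<rho> (single (iv x)) $$ (i, i) * \<sigma> (single x) $$ (k, l))
        = (\<Sum>i<rep_dim \<sigma>. if i = l then if k = l then of_nat (card H) / of_nat (rep_dim \<sigma>) else 0 else 0)"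
      using k l unfolding True
      by (intro sum.cong) (auto simp: orthogonality_same[OF irr(2)])
    then show ?thesis
      using True l by simp
  next
    case False
    then show ?thesis
      using k l by (simp add: orthogonality_inequivalent[OF irr ineq])
  qed
  finally show ?thesis .
qed

lemma character_orthogonality:
  assumes compl: "complete_irreps H e I" and \<rho>: "\<rho> \<in> I" and \<sigma>: "\<sigma> \<in> I"
  shows "(\<Sum>x\<in>H. character \<rho> (iv x) * character \<sigma> x) = (if \<rho> = \<sigma> then of_nat (card H) else 0)"
proof -
  have "rep_dim \<sigma> > 0"
    using compl \<sigma> irreducible_repD(2) by (auto simp: complete_irreps_def)
  have "(\<Sum>x\<in>H. character \<rho> (iv x) * character \<sigma> x)
      = (\<Sum>k<rep_dim \<sigma>. \<Sum>x\<in>H. character \<rho> (iv x) * \<sigma> (single x) $$ (k, k))"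
    by (simp add: character_def[of \<sigma>] sum_distrib_left) (rule sum.swap)
  also have "\<dots> = (if \<rho> = \<sigma> then of_nat (card H) else 0)"
    using \<open>rep_dim \<sigma> > 0\<close> by (simp add: character_averages_to_projection[OF compl \<rho> \<sigma>])
  finally show ?thesis .
qed

lemma card_pos: "card H > 0"
  using e_closed by (simp add: card_gt_0_iff) blast

text \<open>
  Distinct members have orthogonal, hence linearly independent, characters in a finite-dimensional
  space of functions.
\<close>

lemma finite_complete_irreps:
  assumes compl: "complete_irreps H e I"
  shows "finite I"
proof -
  have inj: "inj_on character I"
  proof (rule inj_onI)
    fix \<rho> \<sigma>
    assume \<rho>: "\<rho> \<in> I" and \<sigma>: "\<sigma> \<in> I" and eq: "character \<rho> = character \<sigma>"
    show "\<rho> = \<sigma>"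
      using character_orthogonality[OF compl \<rho> \<sigma>] character_orthogonality[OF compl \<rho> \<rho>] card_pos eq
      by (auto split: if_splits)
  qed
  have "alg.independent (character ` I)"
    unfolding alg.independent_explicit_module
  proof (intro allI impI)
    fix T :: "'a alg set" and c v
    assume T: "finite T" "T \<subseteq> character ` I" and sum: "(\<Sum>v\<in>T. (\<lambda>x. c v * v x)) = 0" and v: "v \<in> T"
    obtain \<rho> where \<rho>: "\<rho> \<in> I" "v = character \<rho>"
      using T v by blast
    have pair: "(\<Sum>x\<in>H. character \<rho> (iv x) * w x) = (if w = v then of_nat (card H) else 0)" if w: "w \<in> T" for w
    proof -
      obtain \<sigma> where \<sigma>: "\<sigma> \<in> I" "w = character \<sigma>"
        using T w by blast
      then have "w = v \<longleftrightarrow> \<rho> = \<sigma>"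
        using \<rho> inj by (auto simp: inj_on_def)
      then show ?thesis
        using character_orthogonality[OF compl \<rho>(1) \<sigma>(1)] \<sigma>(2) by simp
    qed
    have "0 = (\<Sum>x\<in>H. character \<rho> (iv x) * (\<Sum>w\<in>T. c w * w x))"
      using fun_cong[OF sum] by (simp add: sum_fun_apply)
    also have "\<dots> = (\<Sum>x\<in>H. \<Sum>w\<in>T. c w * (character \<rho> (iv x) * w x))"
      by (simp add: sum_distrib_left mult.left_commute)
    also have "\<dots> = (\<Sum>w\<in>T. c w * (\<Sum>x\<in>H. character \<rho> (iv x) * w x))"
      by (subst sum.swap) (simp add: sum_distrib_left)
    also have "\<dots> = (\<Sum>w\<in>T. if w = v then c w * of_nat (card H) else 0)"
      by (intro sum.cong) (simp_all add: pair)
    also have "\<dots> = c v * of_nat (card H)"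
      using T v by simp
    finally show "c v = 0"
      using card_pos by auto
  qed
  then have "finite (character ` I)"
    by (rule alg.finiteI_independent)
  then show ?thesis
    using inj by (rule finite_imageD)
qed

text \<open>
  The group algebra element \<open>F\<close> collects the differences of the two sides. By
  \<open>character_averages_to_projection\<close> every member of \<open>I\<close> maps it to zero, so \<open>F\<close> is zero.
\<close>

lemma column_orthogonality:
  assumes compl: "complete_irreps H e I" and h: "h \<in> H"
  shows "(\<Sum>\<rho>\<in>I. of_nat (rep_dim \<rho>) * character \<rho> h) = (if h = e then of_nat (card H) else 0)"
proof -
  \<comment> \<open>the coefficient at \<open>iv h\<close> will compare the two sides at \<open>h\<close>\<close>
  define F where "F x = (if x \<in> H then (if x = e then of_nat (card H) else 0)
    - (\<Sum>\<rho>\<in>I. of_nat (rep_dim \<rho>) * character \<rho> (iv x)) else 0)" for x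
  have FH: "F \<in> alg_on H"
    by (simp add: F_def alg_on_def)
  have "F = (\<lambda>_. 0)"
  proof (rule annihilated_by_irreducibles_eq_0[OF compl FH])
    fix \<sigma>
    assume \<sigma>: "\<sigma> \<in> I"
    then have irr: "irreducible_rep H e \<sigma>"
      using compl by (simp add: complete_irreps_def)
    let ?d = "rep_dim \<sigma>"
    show "\<sigma> F = 0\<^sub>m ?d ?d"
    proof (rule eq_matI)
      fix k l
      assume "k < dim_row (0\<^sub>m ?d ?d :: complex mat)" "l < dim_col (0\<^sub>m ?d ?d :: complex mat)"
      then have k: "k < ?d" and l: "l < ?d" by auto
      let ?s = "\<lambda>x. \<sigma> (single x) $$ (k, l)"
      have "\<sigma> F $$ (k, l) = (\<Sum>x\<in>H. F x * ?s x)"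
        by (rule linear_to_mat_expand[OF irreducible_repD(4)[OF irr] FH k l])
      also have "\<dots> = (\<Sum>x\<in>H. (if x = e then of_nat (card H) * ?s x else 0)
          - (\<Sum>\<rho>\<in>I. of_nat (rep_dim \<rho>) * (character \<rho> (iv x) * ?s x)))"
        by (intro sum.cong) (auto simp: F_def left_diff_distrib sum_distrib_right mult.assoc)
      also have "\<dots> = of_nat (card H) * ?s e
          - (\<Sum>\<rho>\<in>I. of_nat (rep_dim \<rho>) * (\<Sum>x\<in>H. character \<rho> (iv x) * ?s x))"
        by (simp add: sum_subtractf e_closed sum_distrib_left) (rule sum.swap)
      also have "(\<Sum>\<rho>\<in>I. of_nat (rep_dim \<rho>) * (\<Sum>x\<in>H. character \<rho> (iv x) * ?s x))
          = (\<Sum>\<rho>\<in>I. if \<rho> = \<sigma> then (if k = l then of_nat (card H) else 0) else 0)"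
        using irreducible_repD(2)[OF irr]
        by (intro sum.cong) (auto simp: character_averages_to_projection[OF compl _ \<sigma> k l])
      also have "\<dots> = (if k = l then of_nat (card H) else 0)"
        using \<sigma> finite_complete_irreps[OF compl] by simp
      also have "of_nat (card H) * ?s e - \<dots> = 0"
        by (simp add: representation_e_entry[OF irreducible_repD(1)[OF irr] k l])
      finally show "\<sigma> F $$ (k, l) = 0\<^sub>m ?d ?d $$ (k, l)"
        using k l by simp
    qed (use irreducible_repD(3)[OF irr FH] in auto)
  qed
  then have "F (iv h) = 0" by simp
  moreover have "iv h = e \<longleftrightarrow> h = e"
    using inv_inv[OF h] inv_e by metis
  ultimately show ?thesis
    using h by (auto simp: F_def inv_closed inv_inv split: if_splits)
qed

end

section \<open>Fourier inversion\<close>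

lemma max_subgroup_group:
  fixes e :: "'a::{finite, inverse_semigroup}"
  assumes e: "e \<in> idempotents"
  shows "finite_group_in_semigroup (max_subgroup e) e sinv"
proof
  show "x * y \<in> max_subgroup e" if "x \<in> max_subgroup e" "y \<in> max_subgroup e" for x y
    using that by (simp add: max_subgroup_def sdom_mult sran_mult)
  show "e \<in> max_subgroup e"
    using e by (simp add: max_subgroup_def sdom_idempotent sran_idempotent)
  fix x
  assume x: "x \<in> max_subgroup e"
  then show "sinv x \<in> max_subgroup e"
    by (simp add: max_subgroup_def)
  show "e * x = x" "x * e = x"
    using x sran_mult_self[of x] mult_sdom_self[of x] by (simp_all add: max_subgroup_def)
  show "sinv x * x = e" "x * sinv x = e"
    using x by (simp_all add: max_subgroup_def sdom_def sran_def)
qed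

lemma induced_rep_spec:
  fixes Dk :: "'a::{finite, inverse_semigroup} set"
  defines "r \<equiv> card (idempotents \<inter> Dk)"
  assumes \<rho>: "\<And>s. s \<in> Dk \<Longrightarrow>
    \<rho> (single (sinv (p (sran s)) * s * p (sdom s))) \<in> carrier_mat (rep_dim \<rho>) (rep_dim \<rho>)"
  shows "linear_to_mat (alg_on UNIV) (r * rep_dim \<rho>) (induced_rep Dk ix p \<rho>)"
    and "induced_rep Dk ix p \<rho> (groupoid_basis s) =
      (if s \<in> Dk
       then kronecker (mat_unit r (ix (sran s)) (ix (sdom s))) (\<rho> (single (sinv (p (sran s)) * s * p (sdom s))))
       else 0\<^sub>m (r * rep_dim \<rho>) (r * rep_dim \<rho>))"
proof -
  define M where "M s = (if s \<in> Dk
       then kronecker (mat_unit r (ix (sran s)) (ix (sdom s))) (\<rho> (single (sinv (p (sran s)) * s * p (sdom s))))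
       else 0\<^sub>m (r * rep_dim \<rho>) (r * rep_dim \<rho>))" for s
  have M: "M s \<in> carrier_mat (r * rep_dim \<rho>) (r * rep_dim \<rho>)" for s
    using \<rho>[of s] by (auto simp: M_def kronecker_def mat_unit_def)
  have eq: "induced_rep Dk ix p \<rho> =
      (THE R. linear_to_mat (alg_on UNIV) (r * rep_dim \<rho>) R \<and> (\<forall>s. R (groupoid_basis s) = M s))"
    by (simp only: induced_rep_def Let_def M_def r_def)
  have "linear_to_mat (alg_on UNIV) (r * rep_dim \<rho>) (induced_rep Dk ix p \<rho>)
      \<and> (\<forall>s. induced_rep Dk ix p \<rho> (groupoid_basis s) = M s)"
    unfolding eq by (rule theI'[OF ex1_linear_on_groupoid_basis[OF M]])
  then show "linear_to_mat (alg_on UNIV) (r * rep_dim \<rho>) (induced_rep Dk ix p \<rho>)"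
    and "induced_rep Dk ix p \<rho> (groupoid_basis s) =
      (if s \<in> Dk
       then kronecker (mat_unit r (ix (sran s)) (ix (sdom s))) (\<rho> (single (sinv (p (sran s)) * s * p (sdom s))))
       else 0\<^sub>m (r * rep_dim \<rho>) (r * rep_dim \<rho>))"
    unfolding M_def by blast+
qed

lemma block_index_less:
  fixes a r i d :: nat
  assumes "a < r" "i < d"
  shows "a * d + i < r * d"
proof -
  have "a * d + i < Suc a * d" using assms by simp
  also have "\<dots> \<le> r * d" using assms by (intro mult_le_mono1) simp
  finally show ?thesis .
qed

lemma kronecker_mat_unit_entry:
  assumes "B \<in> carrier_mat d d" "a < r" "b < r" "i < d" "j < d"
  shows "kronecker (mat_unit r a' b') B $$ (a * d + i, b * d + j)
    = (if a = a' \<and> b = b' then B $$ (i, j) else 0)"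
  using assms block_index_less[of a r i d] block_index_less[of b r j d]
  by (auto simp: kronecker_def mat_unit_def)

text \<open>
  Only the basis elements with range \<open>a\<close> and domain \<open>b\<close> contribute to the block at \<open>(a, b)\<close>.
\<close>

lemma induced_rep_block_entry:
  fixes g :: "'a::{finite, inverse_semigroup} \<Rightarrow> complex"
  assumes ix: "bij_betw ix (idempotents \<inter> Dk) {0..<card (idempotents \<inter> Dk)}"
    and Dk: "\<And>t. t \<in> Dk \<Longrightarrow> sran t \<in> idempotents \<inter> Dk \<and> sdom t \<in> idempotents \<inter> Dk"
    and \<rho>: "\<And>t. t \<in> Dk \<Longrightarrow>
      \<rho> (single (sinv (p (sran t)) * t * p (sdom t))) \<in> carrier_mat (rep_dim \<rho>) (rep_dim \<rho>)"
    and a: "a \<in> idempotents \<inter> Dk" and b: "b \<in> idempotents \<inter> Dk"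
    and i: "i < rep_dim \<rho>" and j: "j < rep_dim \<rho>"
  shows "mat_block (rep_dim \<rho>) (induced_rep Dk ix p \<rho> (\<lambda>x. \<Sum>t\<in>UNIV. g t * groupoid_basis t x)) (ix a) (ix b) $$ (i, j)
    = (\<Sum>t | t \<in> Dk \<and> sran t = a \<and> sdom t = b. g t * \<rho> (single (sinv (p a) * t * p b)) $$ (i, j))"
proof -
  let ?d = "rep_dim \<rho>" and ?r = "card (idempotents \<inter> Dk)"
  let ?R = "induced_rep Dk ix p \<rho>"
  let ?i = "ix a * ?d + i" and ?j = "ix b * ?d + j"
  have ixr: "ix f < ?r" if "f \<in> idempotents \<inter> Dk" for f
    using ix that by (auto simp: bij_betw_def)
  have ix_inj: "ix f = ix f' \<longleftrightarrow> f = f'" if "f \<in> idempotents \<inter> Dk" "f' \<in> idempotents \<inter> Dk" for f f'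
    using ix that by (auto simp: bij_betw_def inj_on_def)
  have less: "?i < ?r * ?d" "?j < ?r * ?d"
    using block_index_less[OF ixr[OF a] i] block_index_less[OF ixr[OF b] j] by auto
  have entry: "?R (groupoid_basis t) $$ (?i, ?j)
      = (if t \<in> Dk \<and> sran t = a \<and> sdom t = b then \<rho> (single (sinv (p a) * t * p b)) $$ (i, j) else 0)" for t
  proof (cases "t \<in> Dk")
    case True
    have "ix a = ix (sran t) \<longleftrightarrow> a = sran t" "ix b = ix (sdom t) \<longleftrightarrow> b = sdom t"
      using ix_inj a b Dk[OF True] by auto
    then show ?thesis
      using True kronecker_mat_unit_entry[OF \<rho>[OF True] ixr[OF a] ixr[OF b] i j]
      by (auto simp: induced_rep_spec(2)[OF \<rho>])
  next
    case False
    then show ?thesis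
      using less by (simp add: induced_rep_spec(2)[OF \<rho>])
  qed
  have "?R (\<lambda>x. \<Sum>t\<in>UNIV. g t * groupoid_basis t x) $$ (?i, ?j)
      = (\<Sum>t\<in>UNIV. g t * ?R (groupoid_basis t) $$ (?i, ?j))"
    by (rule linear_to_mat_sum[OF induced_rep_spec(1)[OF \<rho>] _ _ less]) (simp_all add: alg_on_def)
  also have "\<dots> = (\<Sum>t\<in>UNIV. if t \<in> Dk \<and> sran t = a \<and> sdom t = b
      then g t * \<rho> (single (sinv (p a) * t * p b)) $$ (i, j) else 0)"
    by (intro sum.cong) (simp_all add: entry)
  also have "\<dots> = (\<Sum>t | t \<in> Dk \<and> sran t = a \<and> sdom t = b. g t * \<rho> (single (sinv (p a) * t * p b)) $$ (i, j))"
    by (simp add: sum.If_cases)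
  finally show ?thesis
    using i j by (simp add: mat_block_def)
qed

text \<open>
  Multiplication by \<open>sinv u\<close> and \<open>v\<close> moves the elements from the domain of \<open>t\<close> to its range into
  the maximal subgroup, injectively.
\<close>

lemma transport_to_max_subgroup:
  fixes t :: "'a::inverse_semigroup"
  assumes "sdom u = e" "sran u = sran t" "sdom v = e" "sran v = sdom t"
  shows "sinv u * t * v \<in> max_subgroup e" and "u * (sinv u * t * v) * sinv v = t"
proof -
  have ut: "sdom (sinv u) = sran t" using assms by simp
  have "sdom (sinv u * t) = sran v" using assms sdom_mult[OF ut] by simp
  then show "sinv u * t * v \<in> max_subgroup e"
    using assms by (simp add: max_subgroup_def sdom_mult sran_mult ut)
  have "u * (sinv u * t * v) * sinv v = sran u * t * sran v"
    by (simp add: sran_def mult.assoc)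
  also have "\<dots> = t"
    by (simp add: assms sran_mult_self mult_sdom_self)
  finally show "u * (sinv u * t * v) * sinv v = t" .
qed

theorem theorem3p2:
  fixes D :: "nat \<Rightarrow> 'a::{finite, inverse_semigroup} set"
    and n k :: nat
    and e :: "nat \<Rightarrow> 'a"
    and p :: "'a \<Rightarrow> 'a"
    and IRR :: "nat \<Rightarrow> ('a alg \<Rightarrow> complex mat) set"
    and ix :: "'a \<Rightarrow> nat"
    and g :: "'a \<Rightarrow> complex"
    and s y :: 'a
  assumes D_classes: "bij_betw D {0..n} (UNIV // D_rel)"
    and e_idem: "\<And>j. j \<le> n \<Longrightarrow> e j \<in> idempotents \<inter> D j"
    and p_dom_ran: "\<And>j f. j \<le> n \<Longrightarrow> f \<in> idempotents \<inter> D j \<Longrightarrow> sdom (p f) = e j \<and> sran (p f) = f"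
    and p_e: "\<And>j. j \<le> n \<Longrightarrow> p (e j) = e j"
    and IRR: "\<And>j. j \<le> n \<Longrightarrow> complete_irreps (max_subgroup (e j)) (e j) (IRR j)"
    and ix: "\<And>j. j \<le> n \<Longrightarrow>
          bij_betw ix (idempotents \<inter> D j) {0..<card (idempotents \<inter> D j)}"
    and k: "k \<le> n"
    and s: "s \<in> D k"
    and y: "y = sinv (p (sran s)) * s * p (sdom s)"
  shows "g s = 1 / of_nat (card (max_subgroup (e k))) *
    (\<Sum>\<rho>\<in>IRR k. of_nat (rep_dim \<rho>) *
      mat_trace
        (mat_block (rep_dim \<rho>)
           (induced_rep (D k) ix p \<rho> (\<lambda>x. \<Sum>t\<in>UNIV. g t * groupoid_basis t x))
           (ix (sran s)) (ix (sdom s))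
         * \<rho> (single (sinv y))))"
proof -
  let ?G = "max_subgroup (e k)"
  interpret G: finite_group_in_semigroup ?G "e k" sinv
    using e_idem[OF k] by (intro max_subgroup_group) simp
  have class_D: "D k \<in> UNIV // D_rel"
    using D_classes k by (auto simp: bij_betw_def)
  have Dk: "sran t \<in> idempotents \<inter> D k \<and> sdom t \<in> idempotents \<inter> D k" if "t \<in> D k" for t
    using D_class_sran_sdom[OF class_D that] by blast
  have p: "sdom (p (sran t)) = e k" "sran (p (sran t)) = sran t"
    "sdom (p (sdom t)) = e k" "sran (p (sdom t)) = sdom t" if "t \<in> D k" for t
    using p_dom_ran[OF k] Dk[OF that] by blast+
  have y_in: "sinv (p (sran t)) * t * p (sdom t) \<in> ?G" if "t \<in> D k" for t
    by (rule transport_to_max_subgroup(1)) (use p[OF that] in auto)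
  define a b where "a = sran s" and "b = sdom s"
  have ab: "a \<in> idempotents \<inter> D k" "b \<in> idempotents \<inter> D k"
    using Dk[OF s] by (auto simp: a_def b_def)
  have yG: "y \<in> ?G"
    using y_in[OF s] by (simp add: y)
  \<comment> \<open>the elements of the class that contribute to the block at \<open>(a, b)\<close>\<close>
  define L where "L = {t \<in> D k. sran t = a \<and> sdom t = b}"
  define z where "z t = sinv (p a) * t * p b" for t
  have zG: "z t \<in> ?G" if "t \<in> L" for t
    using y_in[of t] that by (auto simp: z_def L_def)
  have z_inj: "z t = y \<longleftrightarrow> t = s" if "t \<in> L" for t
  proof
    assume "z t = y"
    moreover have "p a * z t * sinv (p b) = t"
      unfolding z_def by (rule transport_to_max_subgroup(2)) (use p[of t] that in \<open>auto simp: L_def\<close>)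
    moreover have "p a * y * sinv (p b) = s"
      unfolding y a_def b_def by (rule transport_to_max_subgroup(2)) (use p[OF s] in auto)
    ultimately show "t = s" by simp
  qed (simp add: z_def y a_def b_def)
  \<comment> \<open>the trace of a product of two values of \<open>\<rho>\<close> is a character value\<close>
  have trace: "mat_trace (mat_block (rep_dim \<rho>)
      (induced_rep (D k) ix p \<rho> (\<lambda>x. \<Sum>t\<in>UNIV. g t * groupoid_basis t x)) (ix a) (ix b) * \<rho> (single (sinv y)))
    = (\<Sum>t\<in>L. g t * G.character \<rho> (z t * sinv y))" if "\<rho> \<in> IRR k" for \<rho>
  proof -
    let ?d = "rep_dim \<rho>"
    let ?B = "mat_block ?d (induced_rep (D k) ix p \<rho> (\<lambda>x. \<Sum>t\<in>UNIV. g t * groupoid_basis t x)) (ix a) (ix b)"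
    have irr: "irreducible_rep ?G (e k) \<rho>"
      using IRR[OF k] that by (simp add: complete_irreps_def)
    have carr: "\<rho> (single x) \<in> carrier_mat ?d ?d" if "x \<in> ?G" for x
      using irreducible_repD(3)[OF irr alg_on_single[OF that]] .
    have B: "?B \<in> carrier_mat ?d ?d"
      by (simp add: mat_block_def)
    have Y: "\<rho> (single (sinv y)) \<in> carrier_mat ?d ?d"
      by (rule carr[OF G.inv_closed[OF yG]])
    have entry: "?B $$ (i, m) = (\<Sum>t\<in>L. g t * \<rho> (single (z t)) $$ (i, m))" if "i < ?d" "m < ?d" for i m
      unfolding L_def z_def
      by (rule induced_rep_block_entry[OF ix[OF k] Dk carr[OF y_in] ab that])
    have "mat_trace (?B * \<rho> (single (sinv y))) = (\<Sum>i<?d. \<Sum>m<?d. ?B $$ (i, m) * \<rho> (single (sinv y)) $$ (m, i))"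
      using B mat_mult_entry[OF B Y] unfolding mat_trace_def by (auto intro!: sum.cong)
    also have "\<dots> = (\<Sum>i<?d. \<Sum>m<?d. \<Sum>t\<in>L. g t * (\<rho> (single (z t)) $$ (i, m) * \<rho> (single (sinv y)) $$ (m, i)))"
      by (intro sum.cong refl) (simp add: entry sum_distrib_right mult.assoc)
    also have "\<dots> = (\<Sum>i<?d. \<Sum>t\<in>L. \<Sum>m<?d. g t * (\<rho> (single (z t)) $$ (i, m) * \<rho> (single (sinv y)) $$ (m, i)))"
      by (intro sum.cong refl sum.swap)
    also have "\<dots> = (\<Sum>t\<in>L. \<Sum>i<?d. \<Sum>m<?d. g t * (\<rho> (single (z t)) $$ (i, m) * \<rho> (single (sinv y)) $$ (m, i)))"
      by (rule sum.swap)
    also have "\<dots> = (\<Sum>t\<in>L. g t * G.character \<rho> (z t * sinv y))"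
      by (intro sum.cong refl)
         (simp add: G.character_mult[OF irreducible_repD(1)[OF irr] zG G.inv_closed[OF yG]] sum_distrib_left)
    finally show ?thesis .
  qed
  have "(\<Sum>\<rho>\<in>IRR k. of_nat (rep_dim \<rho>) *
      mat_trace
        (mat_block (rep_dim \<rho>)
           (induced_rep (D k) ix p \<rho> (\<lambda>x. \<Sum>t\<in>UNIV. g t * groupoid_basis t x))
           (ix a) (ix b)
         * \<rho> (single (sinv y))))
      = (\<Sum>\<rho>\<in>IRR k. \<Sum>t\<in>L. g t * (of_nat (rep_dim \<rho>) * G.character \<rho> (z t * sinv y)))"
    by (intro sum.cong refl) (simp add: trace sum_distrib_left mult.left_commute)
  also have "\<dots> = (\<Sum>t\<in>L. g t * (\<Sum>\<rho>\<in>IRR k. of_nat (rep_dim \<rho>) * G.character \<rho> (z t * sinv y)))"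
    by (subst sum.swap) (simp add: sum_distrib_left)
  also have "\<dots> = (\<Sum>t\<in>L. if t = s then g t * of_nat (card ?G) else 0)"
  proof (intro sum.cong refl)
    fix t
    assume t: "t \<in> L"
    have "z t * sinv y = e k \<longleftrightarrow> z t = y"
      using G.mult_inv_right_cancel[OF zG[OF t] yG] G.e_left[OF yG] G.inv_right[OF yG] by metis
    then show "g t * (\<Sum>\<rho>\<in>IRR k. of_nat (rep_dim \<rho>) * G.character \<rho> (z t * sinv y))
        = (if t = s then g t * of_nat (card ?G) else 0)"
      by (simp add: G.column_orthogonality[OF IRR[OF k] G.mult_closed[OF zG[OF t] G.inv_closed[OF yG]]] z_inj[OF t])
  qed
  also have "\<dots> = g s * of_nat (card ?G)"
    using s by (simp add: L_def a_def b_def)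
  finally show ?thesis
    using G.card_pos by (auto simp: a_def b_def)
qed

end
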